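(* Let $(c_n)_{n\in\mathbb N}$ be a sequence of non-negative real numbers with $\sum_{n\in\mathbb N}c_n=1$, let $(\vartheta_n)_{n\in\mathbb N}$ be independent random variables, each uniformly distributed on $[0,2\pi)$, and put $\zeta_n=e^{i\vartheta_n}$. Let $\mu=\sum_{n\in\mathbb N}c_n\delta_{\zeta_n}$ and let $\varphi$ be the associated random inner function $$\varphi(z)=\frac{H\mu(z)-1}{H\mu(z)+1},\qquad H\mu(z)=\int_{\mathbb T}\frac{\zeta+z}{\zeta-z}\,d\mu(\zeta),\qquad z\in\mathbb D.$$ For $\alpha\in\mathbb T$ let $\sigma_\alpha$ be the Clark measure of $\varphi$ at $\alpha$, decomposed as $\sigma_\alpha=\eta_\alpha+d_\alpha$ with $\eta_\alpha$ singular continuous and $d_\alpha$ purely atomic. (i) If $\sum_n c_n^{1/2}<\infty$, then almost surely $\sigma_\alpha=d_\alpha$ for $m$-a.e. $\alpha\in\mathbb T$. (ii) If $\sum_n c_n^{1/2}=\infty$, then almost surely $\sigma_\alpha=\eta_\alpha$ for $m$-a.e. $\alpha\in\mathbb T\setminus\{1\}$.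
   Context: $\mathbb D$ is the open unit disk in $\mathbb C$, $\mathbb T=\partial\mathbb D$, and $m$ is normalized Lebesgue measure on $\mathbb T$. An inner function is an analytic map $\mathbb D\to\mathbb D$ with radial limits of modulus $1$ at $m$-almost every point of $\mathbb T$; the random function $\varphi$ in the claim is inner. For an analytic map $\varphi:\mathbb D\to\mathbb D$ and $\alpha\in\mathbb T$, the Clark measure $\sigma_\alpha=\sigma_{\varphi,\alpha}$ is the finite positive Borel measure on $\mathbb T$ determined by $$\mathrm{Re}\left(\frac{\alpha+\varphi(z)}{\alpha-\varphi(z)}\right)=\int_{\mathbb T}\frac{1-|z|^2}{|\zeta-z|^2}\,d\sigma_{\varphi,\alpha}(\zeta),\qquad z\in\mathbb D.$$ When $\varphi$ is inner, every $\sigma_\alpha$ is singular with respect to $m$, so by the Lebesgue decomposition it is uniquely the sum of a singular continuous (non-atomic) measure $\eta_\alpha$ and a purely atomic (discrete) measure $d_\alpha$. *)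

theory Defs
  imports "HOL-Probability.Probability"
begin

text \<open>
  A Borel measure on the unit circle is a measure \<open>\<mu>\<close> with \<open>sets \<mu> = sets circle_borel\<close>; its
  underlying space is then the circle itself, not the whole complex plane.
\<close>

abbreviation circle_borel :: "complex measure" where
  "circle_borel \<equiv> restrict_space borel (sphere 0 1)"

definition circle_measure :: "complex measure" where
  "circle_measure = distr (uniform_measure lborel {0..<2*pi}) circle_borel cis"

lemma singleton_in_circle_borel: "cmod x = 1 \<Longrightarrow> {x} \<in> sets circle_borel"
  by (subst sets_restrict_space_iff) auto

text \<open>
  \<open>\<Sum>\<^sub>n c\<^sub>n \<delta>(\<zeta>\<^sub>n)\<close>, realised as the image under \<open>\<zeta>\<close> of the measure on the natural numbers that
  gives \<open>n\<close> the mass \<open>c\<^sub>n\<close>; see \<open>emeasure_point_masses\<close>.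
\<close>

definition point_masses :: "(nat \<Rightarrow> real) \<Rightarrow> (nat \<Rightarrow> complex) \<Rightarrow> complex measure" where
  "point_masses c \<zeta> = distr (density (count_space UNIV) (\<lambda>n. ennreal (c n))) circle_borel \<zeta>"

lemma emeasure_point_masses:
  assumes "\<And>n. cmod (\<zeta> n) = 1" "A \<in> sets circle_borel"
  shows "emeasure (point_masses c \<zeta>) A =
    (\<Sum>n. ennreal (c n) * emeasure (return circle_borel (\<zeta> n)) A)"
proof -
  have "\<zeta> \<in> measurable (density (count_space UNIV) (\<lambda>n. ennreal (c n))) circle_borel"
    using assms(1) by (auto simp: measurable_def space_restrict_space)
  then have "emeasure (point_masses c \<zeta>) A =
      (\<integral>\<^sup>+n. ennreal (c n) * indicator (\<zeta> -` A) n \<partial>count_space UNIV)"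
    using assms(2) by (simp add: point_masses_def emeasure_distr emeasure_density)
  also have "\<dots> = (\<Sum>n. ennreal (c n) * indicator (\<zeta> -` A) n)"
    by (rule nn_integral_count_space_nat)
  also have "\<dots> = (\<Sum>n. ennreal (c n) * emeasure (return circle_borel (\<zeta> n)) A)"
    using assms(2) by (intro suminf_cong) (auto simp: indicator_def)
  finally show ?thesis .
qed

definition herglotz :: "complex measure \<Rightarrow> complex \<Rightarrow> complex" where
  "herglotz \<mu> z = (LINT \<zeta>|\<mu>. (\<zeta> + z) / (\<zeta> - z))"

definition associated_inner :: "complex measure \<Rightarrow> complex \<Rightarrow> complex" where
  "associated_inner \<mu> z = (herglotz \<mu> z - 1) / (herglotz \<mu> z + 1)"

definition is_clark_measure :: "(complex \<Rightarrow> complex) \<Rightarrow> complex \<Rightarrow> complex measure \<Rightarrow> bool" where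
  "is_clark_measure \<phi> \<alpha> \<sigma> \<longleftrightarrow>
     sets \<sigma> = sets circle_borel \<and> finite_measure \<sigma> \<and>
     (\<forall>z\<in>ball 0 1. Re ((\<alpha> + \<phi> z) / (\<alpha> - \<phi> z)) =
        (LINT \<zeta>|\<sigma>. (1 - (cmod z)\<^sup>2) / (cmod (\<zeta> - z))\<^sup>2))"

text \<open>
  For analytic \<open>\<phi>\<close> from the unit disc to itself and \<open>\<bar>\<alpha>\<bar> = 1\<close>, Herglotz's representation theorem
  provides exactly one such \<open>\<sigma>\<close>.
\<close>

definition clark_measure :: "(complex \<Rightarrow> complex) \<Rightarrow> complex \<Rightarrow> complex measure" where
  "clark_measure \<phi> \<alpha> = (THE \<sigma>. is_clark_measure \<phi> \<alpha> \<sigma>)"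

definition purely_atomic :: "complex measure \<Rightarrow> bool" where
  "purely_atomic \<nu> \<longleftrightarrow> (\<exists>C\<in>sets \<nu>. countable C \<and> emeasure \<nu> (space \<nu> - C) = 0)"

definition singular_continuous :: "complex measure \<Rightarrow> bool" where
  "singular_continuous \<nu> \<longleftrightarrow>
     (\<forall>x\<in>space \<nu>. emeasure \<nu> {x} = 0) \<and>
     (\<exists>N\<in>sets circle_borel. emeasure circle_measure N = 0 \<and> emeasure \<nu> (space \<nu> - N) = 0)"

definition is_singular_decomposition ::
    "complex measure \<Rightarrow> complex measure \<Rightarrow> complex measure \<Rightarrow> bool" where
  "is_singular_decomposition \<sigma> \<eta> d \<longleftrightarrow>
     sets \<eta> = sets circle_borel \<and> sets d = sets circle_borel \<and>
     singular_continuous \<eta> \<and> purely_atomic d \<and>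
     (\<forall>A\<in>sets circle_borel. emeasure \<sigma> A = emeasure \<eta> A + emeasure d A)"

text \<open>
  The two parts below are meaningful only for measures \<open>\<sigma>\<close> on the circle that are singular with
  respect to \<open>circle_measure\<close>, since no absolutely continuous part is provided for.
\<close>

definition sc_part :: "complex measure \<Rightarrow> complex measure" where
  "sc_part \<sigma> = (THE \<eta>. \<exists>d. is_singular_decomposition \<sigma> \<eta> d)"

definition discrete_part :: "complex measure \<Rightarrow> complex measure" where
  "discrete_part \<sigma> = (THE d. \<exists>\<eta>. is_singular_decomposition \<sigma> \<eta> d)"

lemma singular_decomposition_eq:
  assumes "is_singular_decomposition \<sigma> \<eta> d" "is_singular_decomposition \<sigma> \<eta>' d'"
  shows "\<eta> = \<eta>' \<and> d = d'"
proof -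
  have sets: "sets \<eta> = sets circle_borel" "sets d = sets circle_borel"
    "sets \<eta>' = sets circle_borel" "sets d' = sets circle_borel"
    using assms by (auto simp: is_singular_decomposition_def)
  note spaces = sets[THEN sets_eq_imp_space_eq]
  obtain C where C: "C \<in> sets d" "countable C" "emeasure d (space d - C) = 0"
    using assms(1) by (auto simp: is_singular_decomposition_def purely_atomic_def)
  obtain C' where C': "C' \<in> sets d'" "countable C'" "emeasure d' (space d' - C') = 0"
    using assms(2) by (auto simp: is_singular_decomposition_def purely_atomic_def)
  define D where "D = C \<union> C'"
  have D: "D \<in> sets circle_borel" "countable D"
    using C C' sets by (auto simp: D_def)
  have null: "emeasure \<nu> (A \<inter> D) = 0 \<and> emeasure e (A - D) = 0"
    if dec: "is_singular_decomposition \<sigma> \<nu> e" and A: "A \<in> sets circle_borel"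
      and E: "E \<in> sets e" "E \<subseteq> D" "emeasure e (space e - E) = 0" for \<nu> e A E
  proof
    have s: "sets \<nu> = sets circle_borel" "sets e = sets circle_borel"
      and pt: "\<And>x. x \<in> space \<nu> \<Longrightarrow> emeasure \<nu> {x} = 0"
      using dec by (auto simp: is_singular_decomposition_def singular_continuous_def)
    have AD: "A \<inter> D \<subseteq> space \<nu>"
      using sets.sets_into_space[OF A] s(1)[THEN sets_eq_imp_space_eq] by auto
    have "(\<Union>x\<in>A \<inter> D. {x}) \<in> null_sets \<nu>"
    proof (rule null_sets_UN')
      show "countable (A \<inter> D)"
        using D(2) by (metis countable_Int2)
      show "{x} \<in> null_sets \<nu>" if "x \<in> A \<inter> D" for x
      proof
        show "{x} \<in> sets \<nu>"
          using that AD s(1)[THEN sets_eq_imp_space_eq]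
          by (auto simp: s space_restrict_space intro!: singleton_in_circle_borel)
        show "emeasure \<nu> {x} = 0"
          using pt that AD by auto
      qed
    qed
    then show "emeasure \<nu> (A \<inter> D) = 0"
      by (simp add: null_setsD1)
    have "A - D \<subseteq> space e - E"
      using sets.sets_into_space[OF A] s(2)[THEN sets_eq_imp_space_eq] E by auto
    then have "emeasure e (A - D) \<le> emeasure e (space e - E)"
      using E(1) by (intro emeasure_mono) auto
    then show "emeasure e (A - D) = 0"
      using E(3) by simp
  qed
  have vals: "emeasure \<nu> A = emeasure \<sigma> (A - D) \<and> emeasure e A = emeasure \<sigma> (A \<inter> D)"
    if dec: "is_singular_decomposition \<sigma> \<nu> e" and A: "A \<in> sets circle_borel"
      and E: "E \<in> sets e" "E \<subseteq> D" "emeasure e (space e - E) = 0" for \<nu> e A E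
  proof -
    note n = null[OF dec A E]
    have s: "sets \<nu> = sets circle_borel" "sets e = sets circle_borel"
      and add: "\<And>B. B \<in> sets circle_borel \<Longrightarrow> emeasure \<sigma> B = emeasure \<nu> B + emeasure e B"
      using dec by (auto simp: is_singular_decomposition_def)
    have m: "A \<inter> D \<in> sets circle_borel" "A - D \<in> sets circle_borel"
      using A D(1) by (metis sets.Int, metis sets.Diff)
    have split: "emeasure M A = emeasure M (A \<inter> D) + emeasure M (A - D)"
      if "sets M = sets circle_borel" for M
    proof -
      have "emeasure M ((A \<inter> D) \<union> (A - D)) = emeasure M (A \<inter> D) + emeasure M (A - D)"
        using m that by (intro plus_emeasure[symmetric]) auto
      then show ?thesis
        by (simp add: Int_Diff_Un)
    qed
    show ?thesis
      using split[OF s(1)] split[OF s(2)] add[OF m(1)] add[OF m(2)] n by simp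
  qed
  have sub: "C \<subseteq> D" "C' \<subseteq> D"
    by (auto simp: D_def)
  have "\<eta> = \<eta>'"
    using vals[OF assms(1) _ C(1) sub(1) C(3)] vals[OF assms(2) _ C'(1) sub(2) C'(3)]
    by (intro measure_eqI) (simp_all add: sets)
  moreover have "d = d'"
    using vals[OF assms(1) _ C(1) sub(1) C(3)] vals[OF assms(2) _ C'(1) sub(2) C'(3)]
    by (intro measure_eqI) (simp_all add: sets)
  ultimately show ?thesis ..
qed

lemma sc_part_eq: "is_singular_decomposition \<sigma> \<eta> d \<Longrightarrow> sc_part \<sigma> = \<eta>"
  unfolding sc_part_def by (rule the_equality) (auto dest: singular_decomposition_eq)

lemma discrete_part_eq: "is_singular_decomposition \<sigma> \<eta> d \<Longrightarrow> discrete_part \<sigma> = d"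
  unfolding discrete_part_def by (rule the_equality) (auto dest: singular_decomposition_eq)

end

theory Submission
  imports Defs "HOL-Complex_Analysis.Complex_Analysis"
begin

text \<open>
  Write \<open>H\<close> for the Herglotz transform of \<open>\<mu> = \<Sum>\<^sub>n c\<^sub>n \<delta>(\<zeta>\<^sub>n)\<close>, \<open>m\<close> for the normalised arc length and
  \<open>\<sigma>\<^sub>\<alpha>\<close> for the Clark measures of \<open>\<phi> = (H - 1) / (H + 1)\<close>. Everything is governed by the energy
  \<open>G(z) = \<Sum>\<^sub>n c\<^sub>n / \<bar>\<zeta>\<^sub>n - z\<bar>\<^sup>2\<close>, because a point \<open>x\<close> of the circle can be an atom of some \<open>\<sigma>\<^sub>\<alpha>\<close> with
  \<open>\<alpha> \<noteq> 1\<close> only if \<open>G\<close> stays bounded along the radius to \<open>x\<close>, and, conversely, a point with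
  \<open>G(x) < \<infinity>\<close> at which \<open>\<phi>\<close> has radial limit \<open>\<alpha>\<close> is an atom of \<open>\<sigma>\<^sub>\<alpha>\<close>. Both facts come from the
  identity \<open>(P \<sigma>\<^sub>\<alpha>)(z) = 4 Re H(z) / \<bar>(\<alpha> - 1) H(z) + (\<alpha> + 1)\<bar>\<^sup>2\<close> for the Poisson integral of \<open>\<sigma>\<^sub>\<alpha>\<close> and
  from \<open>Re H(z) = (1 - \<bar>z\<bar>\<^sup>2) G(z)\<close> (\<open>finite_near_atom\<close>, \<open>atom_if_radial_limit\<close>).

  Statements about \<open>m\<close>-almost every point of the circle are transferred to \<open>\<sigma>\<^sub>\<alpha>\<close> for \<open>m\<close>-almost every
  \<open>\<alpha>\<close> by the identity \<open>\<integral> \<sigma>\<^sub>\<alpha> dm(\<alpha>) = m\<close> (\<open>average_clark\<close>, \<open>AE_clark\<close>): both sides have the same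
  Poisson integral, since that of \<open>\<sigma>\<^sub>\<alpha>\<close> at \<open>z\<close> is the Poisson kernel at \<open>(\<phi>(z), \<alpha>)\<close>, whose mean over
  \<open>\<alpha>\<close> is \<open>1\<close>. The same computation with the weight \<open>cnj \<alpha>\<close> bounds
  \<open>\<integral> \<integral> \<bar>\<alpha> - \<phi>(r\<^sup>2 x)\<bar>\<^sup>2 d\<sigma>\<^sub>\<alpha>(x) dm(\<alpha>)\<close> by \<open>2 - 2 \<integral> \<bar>\<phi>(r x)\<bar>\<^sup>2 dm(x)\<close>, which tends to \<open>0\<close> as \<open>r\<close>
  tends to \<open>1\<close> because \<open>\<phi>\<close> is inner. So along some radii \<open>\<rho>\<^sub>k\<close> tending to \<open>1\<close> one has \<open>\<phi>(\<rho>\<^sub>k x) \<rightarrow> \<alpha>\<close> for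
  \<open>\<sigma>\<^sub>\<alpha>\<close>-almost every \<open>x\<close> (\<open>clark_radial_limit\<close>). As for each \<open>x\<close> there is at most one such \<open>\<alpha>\<close>, this
  also shows that almost every \<open>\<sigma>\<^sub>\<alpha>\<close> is singular (\<open>clark_singular\<close>).

  If \<open>\<Sum>\<^sub>n sqrt c\<^sub>n < \<infinity>\<close>, then \<open>G < \<infinity>\<close> holds \<open>m\<close>-almost everywhere for every choice of the points
  \<open>\<zeta>\<^sub>n\<close>, so almost every \<open>\<sigma>\<^sub>\<alpha>\<close> is carried by its atoms. If \<open>\<Sum>\<^sub>n sqrt c\<^sub>n = \<infinity>\<close>, the second
  Borel-Cantelli lemma gives, for each fixed \<open>x\<close>, almost surely infinitely many \<open>n\<close> with
  \<open>\<bar>\<zeta>\<^sub>n - x\<bar> < sqrt c\<^sub>n\<close>; each of them contributes at least \<open>1\<close> to \<open>G\<close> near \<open>x\<close>. By Fubini's theorem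
  this holds almost surely for \<open>m\<close>-almost every \<open>x\<close>, so almost no point can be an atom of \<open>\<sigma>\<^sub>\<alpha>\<close>.
\<close>

section \<open>Arc length on the circle and the Poisson kernel\<close>

lemma sets_circle_measure [simp, measurable_cong]: "sets circle_measure = sets circle_borel"
  by (simp add: circle_measure_def)

lemma space_circle_borel [simp]: "space circle_borel = sphere 0 1"
  by (simp add: space_restrict_space)

lemma space_circle_measure [simp]: "space circle_measure = sphere 0 1"
  by (simp add: circle_measure_def)

lemma measurable_circle_ident [measurable]: "(\<lambda>x. x) \<in> borel_measurable circle_borel"
  by (intro measurable_restrict_space1) simp

lemma measurable_cnj [measurable]: "cnj \<in> borel_measurable borel"
  by (intro borel_measurable_continuous_onI continuous_intros)

lemma measurable_cis_circle [measurable]: "cis \<in> measurable borel circle_borel"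
  by (intro measurable_restrict_space2) (auto intro!: borel_measurable_continuous_onI continuous_intros)

lemma borel_measurable_circle:
  fixes h :: "complex \<Rightarrow> 'b::real_normed_vector"
  assumes "continuous_on (sphere 0 1) h"
  shows "h \<in> borel_measurable circle_borel"
  using assms by (rule borel_measurable_continuous_on_restrict)

lemma uniform_law_eq_density:
  "uniform_measure lborel {0..<2*pi} = density lborel (\<lambda>t. ennreal (indicator {0..<2*pi} t / (2*pi)))"
proof -
  have "indicator {0..<2*pi} t / ennreal (2*pi) = ennreal (indicator {0..<2*pi} t / (2*pi))" for t :: real
    by (subst divide_ennreal[symmetric]) (auto simp: ennreal_indicator)
  then show ?thesis by (simp add: uniform_measure_def)
qed

lemma prob_space_uniform_law: "prob_space (uniform_measure lborel {0..<2*pi})"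
  by (rule prob_space_uniform_measure) auto

lemma prob_space_circle_measure: "prob_space circle_measure"
  unfolding circle_measure_def
  by (rule prob_space.prob_space_distr[OF prob_space_uniform_law]) simp

interpretation circle: prob_space circle_measure
  by (rule prob_space_circle_measure)

lemma circle_prob_sphere [simp]: "measure circle_measure (sphere 0 1) = 1"
  using circle.prob_space by simp

text \<open>
  Turns a mean over the circle into a contour integral, which gives access to Cauchy's formula.
\<close>

lemma circle_integral_contour:
  fixes f :: "complex \<Rightarrow> complex"
  assumes f: "continuous_on (sphere 0 1) f"
    and I: "((\<lambda>w. f w / w) has_contour_integral I) (circlepath 0 1)"
  shows "(LINT \<zeta>|circle_measure. f \<zeta>) = I / (2 * pi * \<i>)"
proof -
  have [measurable]: "f \<in> borel_measurable circle_borel"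
    by (rule borel_measurable_circle[OF f])
  have cont: "continuous_on A (\<lambda>t. f (cis t))" for A
    by (rule continuous_on_compose2[OF f]) (auto intro!: continuous_intros)
  have [measurable]: "(\<lambda>t. f (cis t)) \<in> borel_measurable borel"
    by (rule borel_measurable_continuous_onI) (rule cont)
  have "((\<lambda>t. \<i> * f (cis t)) has_integral I) {0..2*pi}"
    using I unfolding circlepath_def
    by (subst (asm) has_contour_integral_part_circlepath_iff) (simp_all add: mult.commute)
  then have J: "((\<lambda>t. f (cis t)) has_integral I / \<i>) {0..2*pi}"
    by (drule_tac c="1/\<i>" in has_integral_mult_right) simp
  have si: "set_integrable lborel {0..2*pi} (\<lambda>t. f (cis t))"
    by (rule borel_integrable_atLeastAtMost') (rule cont)
  have "(LINT \<zeta>|circle_measure. f \<zeta>) = (LINT t|uniform_measure lborel {0..<2*pi}. f (cis t))"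
    unfolding circle_measure_def by (rule integral_distr) auto
  also have "\<dots> = (LINT t|lborel. (indicator {0..<2*pi} t / (2*pi)) *\<^sub>R f (cis t))"
    unfolding uniform_law_eq_density by (subst integral_density) auto
  also have "\<dots> = (LINT t|lborel. (1/(2*pi)) *\<^sub>R (indicator {0..2*pi} t *\<^sub>R f (cis t)))"
  proof (rule integral_cong_AE)
    have "AE t in lborel. t \<noteq> 2*pi"
      by (rule AE_lborel_singleton)
    then show "AE t in lborel. (indicator {0..<2*pi} t / (2*pi)) *\<^sub>R f (cis t) =
        (1/(2*pi)) *\<^sub>R (indicator {0..2*pi} t *\<^sub>R f (cis t))"
      by eventually_elim (auto simp: indicator_def)
  qed auto
  also have "\<dots> = (1/(2*pi)) *\<^sub>R (LINT t:{0..2*pi}|lborel. f (cis t))"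
    by (simp only: integral_scaleR_right set_lebesgue_integral_def)
  also have "(LINT t:{0..2*pi}|lborel. f (cis t)) = integral {0..2*pi} (\<lambda>t. f (cis t))"
    by (rule set_borel_integral_eq_integral(2)[OF si])
  also have "\<dots> = I / \<i>" using J by (rule integral_unique)
  finally show ?thesis
    by (simp only: scaleR_conv_of_real of_real_divide of_real_1 times_divide_times_eq mult_1)
qed

definition poisson :: "complex \<Rightarrow> complex \<Rightarrow> real" where
  "poisson z \<zeta> = (1 - (cmod z)\<^sup>2) / (cmod (\<zeta> - z))\<^sup>2"

lemma measurable_poisson [measurable (raw)]:
  assumes [measurable]: "f \<in> borel_measurable M" "g \<in> borel_measurable M"
  shows "(\<lambda>x. poisson (f x) (g x)) \<in> borel_measurable M"
  unfolding poisson_def by measurable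

lemma continuous_on_poisson [continuous_intros]:
  assumes "continuous_on A f" "continuous_on A g" "\<And>x. x \<in> A \<Longrightarrow> g x \<noteq> f x"
  shows "continuous_on A (\<lambda>x. poisson (f x) (g x))"
  unfolding poisson_def using assms by (intro continuous_intros) auto

lemma poisson_nonneg: "cmod z \<le> 1 \<Longrightarrow> 0 \<le> poisson z \<zeta>"
  by (simp add: poisson_def power_le_one)

lemma dist_circle_ge: "cmod \<zeta> = 1 \<Longrightarrow> 1 - cmod z \<le> cmod (\<zeta> - z)"
  by (metis norm_triangle_ineq2)

lemma poisson_radial_quotient: "s < 1 \<Longrightarrow> (1 - s\<^sup>2) / (1 - s)\<^sup>2 = (1 + s) / (1 - s)" for s :: real
proof -
  have "1 - s\<^sup>2 = (1 - s) * (1 + s)" by (simp add: power2_eq_square algebra_simps)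
  then show "s < 1 \<Longrightarrow> ?thesis" by (simp add: power2_eq_square)
qed

lemma poisson_radial_self:
  fixes s :: real
  assumes "cmod x = 1" "s < 1" shows "poisson (of_real s * x) x = (1 + s) / (1 - s)"
proof -
  have "cmod (x - of_real s * x) = cmod (of_real (1 - s) * x)" by (simp add: algebra_simps)
  also have "\<dots> = 1 - s" using assms by (simp only: norm_mult norm_of_real) simp
  finally show ?thesis
    using assms by (simp add: poisson_def norm_mult poisson_radial_quotient)
qed

lemma poisson_le:
  assumes "cmod z < 1" "cmod \<zeta> = 1"
  shows "poisson z \<zeta> \<le> 2 / (1 - cmod z)"
proof -
  have "poisson z \<zeta> \<le> (1 - (cmod z)\<^sup>2) / (1 - cmod z)\<^sup>2"
    unfolding poisson_def using assms dist_circle_ge[OF assms(2), of z]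
    by (intro divide_left_mono power_mono mult_pos_pos zero_less_power) (auto simp: power_le_one)
  also have "\<dots> = (1 + cmod z) / (1 - cmod z)"
    using assms by (intro poisson_radial_quotient)
  also have "\<dots> \<le> 2 / (1 - cmod z)"
    using assms by (intro divide_right_mono) auto
  finally show ?thesis .
qed

lemma poisson_eq_Re:
  assumes "cmod \<zeta> = 1"
  shows "poisson z \<zeta> = Re ((\<zeta> + z) / (\<zeta> - z))"
proof -
  have 1: "(Re \<zeta>)\<^sup>2 + (Im \<zeta>)\<^sup>2 = 1" using assms by (simp add: cmod_power2[symmetric])
  have "Re ((\<zeta> + z) / (\<zeta> - z)) = ((Re \<zeta>)\<^sup>2 + (Im \<zeta>)\<^sup>2 - ((Re z)\<^sup>2 + (Im z)\<^sup>2)) / (cmod (\<zeta> - z))\<^sup>2"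
    unfolding complex_div_cnj[of "\<zeta> + z"] Re_divide_of_real
    by (simp add: power2_eq_square algebra_simps flip: of_real_power)
  then show ?thesis by (simp add: 1 poisson_def cmod_power2[of z])
qed

text \<open>
  The kernel depends only on the angle between its two arguments; this symmetry is what makes
  Poisson averages of functions and of measures adjoint to each other.
\<close>

lemma poisson_rotate:
  assumes "cmod x = 1" "cmod \<zeta> = 1"
  shows "poisson (of_real r * x) \<zeta> = poisson (of_real r * \<zeta>) x"
proof -
  have "(cmod (\<zeta> - of_real r * x))\<^sup>2 = (cmod \<zeta>)\<^sup>2 + r\<^sup>2 * (cmod x)\<^sup>2 - 2 * r * (Re \<zeta> * Re x + Im \<zeta> * Im x)"
    for \<zeta> x unfolding cmod_power2 by (simp add: power2_eq_square algebra_simps)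
  from this[of \<zeta> x] this[of x \<zeta>] assms
  have "(cmod (\<zeta> - of_real r * x))\<^sup>2 = (cmod (x - of_real r * \<zeta>))\<^sup>2" by simp
  then show ?thesis
    unfolding poisson_def using assms by (simp only: norm_mult)
qed

lemma integrable_circle_bounded:
  fixes h :: "complex \<Rightarrow> 'b::{banach, second_countable_topology}"
  assumes "finite_measure \<sigma>" "sets \<sigma> = sets circle_borel" "h \<in> borel_measurable circle_borel"
    "\<And>x. cmod x = 1 \<Longrightarrow> norm (h x) \<le> B"
  shows "integrable \<sigma> h"
proof (rule finite_measure.integrable_const_bound[OF assms(1), of _ B])
  show "h \<in> borel_measurable \<sigma>" using assms(3) by (simp cong: measurable_cong_sets add: assms(2))
  show "AE x in \<sigma>. norm (h x) \<le> B"
    using assms(4) sets_eq_imp_space_eq[OF assms(2)] by (intro AE_I2) auto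
qed

lemma integrable_circle_continuous:
  fixes h :: "complex \<Rightarrow> 'b::{banach, second_countable_topology}"
  assumes "finite_measure \<sigma>" "sets \<sigma> = sets circle_borel" "continuous_on (sphere 0 1) h"
  shows "integrable \<sigma> h"
proof -
  have "bounded (h ` sphere 0 1)"
    by (intro compact_imp_bounded compact_continuous_image assms(3)) simp
  then obtain B where "\<forall>x\<in>sphere 0 1. norm (h x) \<le> B" by (auto simp: bounded_iff)
  then have "\<And>x. cmod x = 1 \<Longrightarrow> norm (h x) \<le> B" by auto
  then show ?thesis
    using integrable_circle_bounded[OF assms(1,2) borel_measurable_circle[OF assms(3)]] by blast
qed

lemma continuous_on_poisson_circle:
  "cmod z < 1 \<Longrightarrow> continuous_on (sphere 0 1) (poisson z)"
  by (intro continuous_intros) auto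

lemma integrable_poisson:
  assumes "finite_measure \<sigma>" "sets \<sigma> = sets circle_borel" "cmod z < 1"
  shows "integrable \<sigma> (poisson z)"
  by (intro integrable_circle_continuous assms continuous_on_poisson_circle)

text \<open>
  On the circle \<open>cnj w = 1 / w\<close>, so the kernel equals \<open>(1 - \<bar>z\<bar>\<^sup>2) w / ((w - z) (1 - cnj z w))\<close>, and the
  claim is Cauchy's integral formula at \<open>z\<close> for \<open>w \<mapsto> f(w) (1 - \<bar>z\<bar>\<^sup>2) / (1 - cnj z w)\<close>.
\<close>

lemma poisson_formula:
  fixes f :: "complex \<Rightarrow> complex"
  assumes f: "continuous_on (cball 0 1) f" "f holomorphic_on ball 0 1" and z: "cmod z < 1"
  shows "(LINT \<zeta>|circle_measure. poisson z \<zeta> *\<^sub>R f \<zeta>) = f z"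
proof -
  define g where "g w = f w * (1 - (cmod z)\<^sup>2) / (1 - cnj z * w)" for w
  have nz: "1 - cnj z * w \<noteq> 0" if "cmod w \<le> 1" for w
  proof
    assume "1 - cnj z * w = 0"
    then have "1 = cmod (cnj z * w)" by simp
    also have "\<dots> \<le> cmod z * 1" unfolding norm_mult using that by (intro mult_mono) auto
    finally show False using z by simp
  qed
  have eq: "poisson z w *\<^sub>R f w / w = g w / (w - z)" if w: "cmod w = 1" for w
  proof -
    have "w * cnj w = 1" using w by (simp add: complex_norm_square[symmetric])
    then have "1 - cnj z * w = w * cnj (w - z)" by (simp add: algebra_simps)
    moreover have "complex_of_real ((cmod (w - z))\<^sup>2) = (w - z) * cnj (w - z)"
      by (simp only: complex_norm_square)
    moreover have "w \<noteq> 0" "w \<noteq> z" using w z by auto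
    ultimately show ?thesis
      by (simp add: poisson_def g_def scaleR_conv_of_real divide_simps)
  qed
  have "continuous_on (cball 0 1) g" "g holomorphic_on ball 0 1"
    unfolding g_def using nz by (auto intro!: continuous_intros holomorphic_intros f)
  then have "((\<lambda>u. g u / (u - z)) has_contour_integral (2 * of_real pi * \<i> * g z)) (circlepath 0 1)"
    using z by (intro Cauchy_integral_circlepath) auto
  then have "((\<lambda>w. poisson z w *\<^sub>R f w / w) has_contour_integral (2 * of_real pi * \<i> * g z)) (circlepath 0 1)"
    by (rule has_contour_integral_eq) (use eq in \<open>auto simp: path_image_circlepath\<close>)
  then have "(LINT \<zeta>|circle_measure. poisson z \<zeta> *\<^sub>R f \<zeta>) = (2 * of_real pi * \<i> * g z) / (2 * pi * \<i>)"
    by (intro circle_integral_contour) (use z in \<open>auto intro!: continuous_intros continuous_on_subset[OF f(1)]\<close>)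
  also have "\<dots> = g z" by simp
  also have "g z = f z"
    using nz[of z] z by (simp add: g_def complex_norm_square[symmetric] mult.commute[of "cnj z"])
  finally show ?thesis .
qed

lemma integral_poisson:
  assumes "cmod z < 1" shows "(LINT \<zeta>|circle_measure. poisson z \<zeta>) = 1"
proof -
  have "(LINT \<zeta>|circle_measure. complex_of_real (poisson z \<zeta>)) = 1"
    using poisson_formula[of "\<lambda>_. 1" z] assms by (simp add: scaleR_conv_of_real)
  then show ?thesis
    using integrable_poisson[OF circle.finite_measure_axioms sets_circle_measure assms]
    by (simp add: of_real_eq_1_iff)
qed

lemma integral_poisson_ident:
  assumes "cmod z < 1" shows "(LINT \<zeta>|circle_measure. poisson z \<zeta> *\<^sub>R \<zeta>) = z"
  using poisson_formula[of "\<lambda>w. w" z] assms by simp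

text \<open>
  The kernel at \<open>s x\<close> has integral \<open>1\<close> but takes a value of at least \<open>1 / (1 - s)\<close> at \<open>x\<close>.
\<close>

lemma circle_measure_singleton:
  assumes x: "cmod x = 1" shows "emeasure circle_measure {x} = 0"
proof -
  have sx: "{x} \<in> sets circle_measure" using singleton_in_circle_borel[OF x] by simp
  have "measure circle_measure {x} \<le> 1 - s" if s: "0 < s" "s < 1" for s
  proof -
    have z: "cmod (of_real s * x) < 1" using s x by (simp add: norm_mult)
    have p: "poisson (of_real s * x) x = (1 + s) / (1 - s)" by (rule poisson_radial_self[OF x s(2)])
    have "measure circle_measure {x} * (1 / (1 - s)) =
        (LINT \<zeta>|circle_measure. indicator {x} \<zeta> * (1 / (1 - s)))"
      using sx x by (simp add: Int_absorb2)
    also have "\<dots> \<le> (LINT \<zeta>|circle_measure. poisson (of_real s * x) \<zeta>)"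
    proof (rule integral_mono)
      show "integrable circle_measure (\<lambda>\<zeta>. indicator {x} \<zeta> * (1 / (1 - s)))"
        using sx by (intro integrable_mult_left integrable_real_indicator) (auto simp: less_top[symmetric])
      show "integrable circle_measure (poisson (of_real s * x))"
        using z by (intro integrable_poisson circle.finite_measure_axioms) auto
      show "indicator {x} \<zeta> * (1 / (1 - s)) \<le> poisson (of_real s * x) \<zeta>" for \<zeta>
        using s z poisson_nonneg[of "of_real s * x" \<zeta>]
        by (cases "\<zeta> = x") (auto simp: p divide_right_mono)
    qed
    also have "\<dots> = 1" by (rule integral_poisson[OF z])
    finally show ?thesis using s by (simp add: field_simps)
  qed
  note A = this
  have "measure circle_measure {x} \<le> 0 + e" if "e > 0" for e
  proof -
    have "1 - min e (1/2) < 1" "0 < 1 - min e (1/2)" using that by (auto simp: min_def)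
    from A[OF this(2,1)] show ?thesis by simp
  qed
  then have "measure circle_measure {x} \<le> 0" by (rule field_le_epsilon)
  then show ?thesis by (simp add: circle.emeasure_eq_measure measure_le_0_iff)
qed

section \<open>Poisson integrals determine measures\<close>

lemma Fubini_bounded:
  fixes f :: "'a \<Rightarrow> 'b \<Rightarrow> 'c::{banach, second_countable_topology}"
  assumes M: "finite_measure M" and N: "finite_measure N"
    and f: "case_prod f \<in> borel_measurable (M \<Otimes>\<^sub>M N)"
    and B: "\<And>x y. x \<in> space M \<Longrightarrow> y \<in> space N \<Longrightarrow> norm (f x y) \<le> B"
  shows "(LINT y|N. LINT x|M. f x y) = (LINT x|M. LINT y|N. f x y)"
proof -
  interpret M: finite_measure M by fact
  interpret N: finite_measure N by fact
  interpret pair_sigma_finite M N ..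
  show ?thesis
  proof (rule Fubini_integral)
    show "integrable (M \<Otimes>\<^sub>M N) (case_prod f)"
      using f B by (intro finite_measure.integrable_const_bound[OF finite_measure_pair_measure[OF N M], of _ B] AE_I2)
        (auto simp: space_pair_measure)
  qed
qed

text \<open>
  A fixed sequence of radii increasing to \<open>1\<close>: all radial limits below are taken along sequences, as
  the convergence theorems for integrals require.
\<close>

definition rad :: "nat \<Rightarrow> real" where "rad k = 1 - 1 / (real k + 2)"

lemma rad_pos [simp]: "0 < rad k" and rad_less_1 [simp]: "rad k < 1"
  and rad_nonneg [simp]: "0 \<le> rad k" and abs_rad [simp]: "\<bar>rad k\<bar> = rad k"
  by (auto simp: rad_def field_simps)

lemma rad_le_1 [simp]: "rad k \<le> 1"
  by (rule less_imp_le) simp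

lemma tendsto_rad: "rad \<longlonglongrightarrow> 1"
  unfolding rad_def by real_asymp

lemma cmod_rad_le: "cmod z \<le> 1 \<Longrightarrow> cmod (of_real (rad k) * z) \<le> rad k"
  by (simp add: norm_mult mult_le_cancel_left1 not_less)

lemma cmod_rad_less: "cmod z \<le> 1 \<Longrightarrow> cmod (of_real (rad k) * z) < 1"
  using cmod_rad_le rad_less_1 le_less_trans by blast

text \<open>
  By continuity at \<open>y\<close>, \<open>\<bar>h x - h y\<bar> \<le> e / 2 + K \<bar>x - y\<bar>\<^sup>2\<close> for a suitable \<open>K\<close>, and the Poisson average
  of \<open>\<bar>x - y\<bar>\<^sup>2\<close> at \<open>s y\<close> is exactly \<open>2 - 2 s\<close>, because \<open>\<bar>x - y\<bar>\<^sup>2 = 2 - 2 Re (cnj y x)\<close> is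
  harmonic in \<open>x\<close>.
\<close>

lemma poisson_approximate_identity:
  fixes h :: "complex \<Rightarrow> real"
  assumes h: "continuous_on (sphere 0 1) h" and y: "cmod y = 1"
  shows "(\<lambda>k. LINT x|circle_measure. h x * poisson (of_real (rad k) * y) x) \<longlonglongrightarrow> h y"
proof (rule LIMSEQ_I)
  fix e :: real assume "e > 0"
  have "bounded (h ` sphere 0 1)"
    by (intro compact_imp_bounded compact_continuous_image h) simp
  then obtain B where B: "\<forall>x\<in>sphere 0 1. norm (h x) \<le> B" by (auto simp: bounded_iff)
  then have "norm (h y) \<le> B" using y by simp
  then have B0: "B \<ge> 0" using norm_ge_zero order_trans by blast
  obtain d where d: "d > 0" "\<And>x. cmod x = 1 \<Longrightarrow> dist x y < d \<Longrightarrow> dist (h x) (h y) < e / 2"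
    using h y \<open>e > 0\<close> unfolding continuous_on_iff by (metis half_gt_zero mem_sphere_0)
  define K where "K = 2 * B / d\<^sup>2"
  have K0: "K \<ge> 0" using B0 by (simp add: K_def)
  have bound: "\<bar>h x - h y\<bar> \<le> e / 2 + K * (cmod (x - y))\<^sup>2" if x: "cmod x = 1" for x
  proof (cases "dist x y < d")
    case True
    then show ?thesis using d(2)[OF x True] K0
      by (simp add: dist_real_def add_increasing2 less_imp_le)
  next
    case False
    then have "d\<^sup>2 \<le> (cmod (x - y))\<^sup>2" using d(1) by (intro power_mono) (auto simp: dist_norm)
    then have "2 * B \<le> K * (cmod (x - y))\<^sup>2"
      using d(1) B0 by (simp add: K_def pos_le_divide_eq mult_left_mono)
    moreover have "\<bar>h x - h y\<bar> \<le> 2 * B"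
      using B x y by (smt (verit) mem_sphere_0 real_norm_def)
    ultimately show ?thesis using \<open>e > 0\<close> by linarith
  qed
  have ineq: "\<bar>(LINT x|circle_measure. h x * poisson (of_real (rad k) * y) x) - h y\<bar> \<le> e / 2 + K * (2 - 2 * rad k)" for k
  proof -
    let ?z = "of_real (rad k) * y"
    have z: "cmod ?z < 1" using y by (intro cmod_rad_less) auto
    note int = integrable_circle_continuous[OF circle.finite_measure_axioms sets_circle_measure]
    have cp: "continuous_on (sphere 0 1) (poisson ?z)" by (rule continuous_on_poisson_circle[OF z])
    have i1: "integrable circle_measure (\<lambda>x. h x * poisson ?z x)"
      "integrable circle_measure (\<lambda>x. h y * poisson ?z x)"
      by (intro int continuous_intros h cp)+
    have i2: "integrable circle_measure (\<lambda>x. (e / 2 + K * (cmod (x - y))\<^sup>2) * poisson ?z x)"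
      by (intro int continuous_intros cp)
    have "(LINT x|circle_measure. h x * poisson ?z x) - h y
        = (LINT x|circle_measure. h x * poisson ?z x - h y * poisson ?z x)"
      using i1 integral_poisson[OF z] by simp
    then have "\<bar>(LINT x|circle_measure. h x * poisson ?z x) - h y\<bar>
        \<le> (LINT x|circle_measure. \<bar>h x * poisson ?z x - h y * poisson ?z x\<bar>)"
      by (simp add: integral_abs_bound)
    also have "\<dots> \<le> (LINT x|circle_measure. (e / 2 + K * (cmod (x - y))\<^sup>2) * poisson ?z x)"
    proof (rule integral_mono)
      show "integrable circle_measure (\<lambda>x. \<bar>h x * poisson ?z x - h y * poisson ?z x\<bar>)"
        by (intro int continuous_intros h cp)
      show "\<bar>h x * poisson ?z x - h y * poisson ?z x\<bar> \<le> (e / 2 + K * (cmod (x - y))\<^sup>2) * poisson ?z x"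
        if "x \<in> space circle_measure" for x
        using bound[of x] that poisson_nonneg[of ?z x] z
        by (simp add: left_diff_distrib[symmetric] abs_mult mult_right_mono)
    qed (rule i2)
    also have "\<dots> = (LINT x|circle_measure. (e / 2 + 2 * K) * poisson ?z x - 2 * K * Re (cnj y * (poisson ?z x *\<^sub>R x)))"
    proof (rule Bochner_Integration.integral_cong[OF refl])
      fix x assume "x \<in> space circle_measure"
      then have x: "(Re x)\<^sup>2 + (Im x)\<^sup>2 = 1" by (simp add: cmod_power2[symmetric])
      have y': "(Re y)\<^sup>2 + (Im y)\<^sup>2 = 1" using y by (simp add: cmod_power2[symmetric])
      define w where "w = Re (cnj y * x)"
      have "(cmod (x - y))\<^sup>2 = ((Re x)\<^sup>2 + (Im x)\<^sup>2) + ((Re y)\<^sup>2 + (Im y)\<^sup>2) - 2 * w"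
        unfolding cmod_power2 w_def by (simp add: power2_eq_square algebra_simps)
      then have "(cmod (x - y))\<^sup>2 = 2 - 2 * w" using x y' by simp
      moreover have "Re (cnj y * (poisson ?z x *\<^sub>R x)) = poisson ?z x * w"
        unfolding w_def by (simp add: algebra_simps)
      ultimately show "(e / 2 + K * (cmod (x - y))\<^sup>2) * poisson ?z x =
          (e / 2 + 2 * K) * poisson ?z x - 2 * K * Re (cnj y * (poisson ?z x *\<^sub>R x))"
        by (simp add: ring_distribs)
    qed
    also have "\<dots> = (e / 2 + 2 * K) * (LINT x|circle_measure. poisson ?z x)
        - 2 * K * Re (cnj y * (LINT x|circle_measure. poisson ?z x *\<^sub>R x))"
    proof -
      have j1: "integrable circle_measure (poisson ?z)" by (intro int cp)
      have j2: "integrable circle_measure (\<lambda>x. poisson ?z x *\<^sub>R x)" by (intro int continuous_intros cp)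
      then have j3: "integrable circle_measure (\<lambda>x. cnj y * (poisson ?z x *\<^sub>R x))"
        by (rule integrable_mult_right)
      have j4: "(LINT x|circle_measure. cnj y * (poisson ?z x *\<^sub>R x))
          = cnj y * (LINT x|circle_measure. poisson ?z x *\<^sub>R x)"
        by (rule Bochner_Integration.integral_mult_right_zero)
      show ?thesis
        unfolding j4[symmetric] integral_Re[OF j3, symmetric]
      proof (subst Bochner_Integration.integral_diff)
        show "integrable circle_measure (\<lambda>x. (e / 2 + 2 * K) * poisson ?z x)"
          by (rule integrable_mult_right[OF j1])
        show "integrable circle_measure (\<lambda>x. 2 * K * Re (cnj y * (poisson ?z x *\<^sub>R x)))"
          by (rule integrable_mult_right[OF integrable_Re[OF j3]])
      qed (simp only: Bochner_Integration.integral_mult_right_zero)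
    qed
    also have "\<dots> = (e / 2 + 2 * K) - 2 * K * Re (cnj y * ?z)"
      using integral_poisson[OF z] integral_poisson_ident[OF z] by simp
    also have "Re (cnj y * ?z) = rad k"
    proof -
      have "Re (cnj y * ?z) = rad k * (cmod y)\<^sup>2"
        unfolding cmod_power2 by (simp add: power2_eq_square algebra_simps)
      then show ?thesis using y by simp
    qed
    finally show ?thesis by (simp add: algebra_simps)
  qed
  have "(\<lambda>k. e / 2 + K * (2 - 2 * rad k)) \<longlonglongrightarrow> e / 2 + K * (2 - 2 * 1)"
    by (intro tendsto_intros tendsto_rad)
  then have "\<forall>\<^sub>F k in sequentially. e / 2 + K * (2 - 2 * rad k) < e"
    by (rule order_tendstoD(2)) (use \<open>e > 0\<close> in simp)
  then obtain n0 where "\<forall>k\<ge>n0. e / 2 + K * (2 - 2 * rad k) < e"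
    unfolding eventually_sequentially by (rule exE)
  then show "\<exists>no. \<forall>k\<ge>no. norm ((LINT x|circle_measure. h x * poisson (of_real (rad k) * y) x) - h y) < e"
    using le_less_trans[OF ineq] by auto
qed

lemma poisson_average_bound:
  fixes h :: "complex \<Rightarrow> real"
  assumes h: "continuous_on (sphere 0 1) h" and B: "\<And>x. cmod x = 1 \<Longrightarrow> \<bar>h x\<bar> \<le> B" and z: "cmod z < 1"
  shows "\<bar>LINT x|circle_measure. h x * poisson z x\<bar> \<le> B"
proof -
  note int = integrable_circle_continuous[OF circle.finite_measure_axioms sets_circle_measure]
  have cp: "continuous_on (sphere 0 1) (poisson z)" by (rule continuous_on_poisson_circle[OF z])
  have "\<bar>LINT x|circle_measure. h x * poisson z x\<bar> \<le> (LINT x|circle_measure. \<bar>h x * poisson z x\<bar>)"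
    by (rule integral_abs_bound)
  also have "\<dots> \<le> (LINT x|circle_measure. B * poisson z x)"
    by (intro integral_mono int continuous_intros h cp)
      (use B poisson_nonneg[of z] z in \<open>auto simp: abs_mult intro!: mult_right_mono\<close>)
  also have "\<dots> = B" using integral_poisson[OF z] by simp
  finally show ?thesis .
qed

text \<open>
  Moving the Poisson average from the measure to the test function by Fubini's theorem and
  \<open>poisson_rotate\<close> reduces this to the approximate identity.
\<close>

lemma integral_eq_lim_poisson:
  fixes h :: "complex \<Rightarrow> real"
  assumes \<sigma>: "finite_measure \<sigma>" "sets \<sigma> = sets circle_borel" and h: "continuous_on (sphere 0 1) h"
  shows "(\<lambda>k. LINT x|circle_measure. h x * (LINT \<zeta>|\<sigma>. poisson (of_real (rad k) * x) \<zeta>))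
    \<longlonglongrightarrow> (LINT \<zeta>|\<sigma>. h \<zeta>)"
proof -
  note [measurable_cong] = \<sigma>(2)
  have sp: "space \<sigma> = sphere 0 1" using sets_eq_imp_space_eq[OF \<sigma>(2)] by simp
  have hm [measurable]: "h \<in> borel_measurable circle_borel" by (rule borel_measurable_circle[OF h])
  have "bounded (h ` sphere 0 1)"
    by (intro compact_imp_bounded compact_continuous_image h) simp
  then obtain B where "\<forall>x\<in>sphere 0 1. norm (h x) \<le> B" by (auto simp: bounded_iff)
  then have B: "\<And>x. cmod x = 1 \<Longrightarrow> \<bar>h x\<bar> \<le> B" by auto
  have meas: "(\<lambda>(x, \<zeta>). h x * poisson (of_real (rad k) * x) \<zeta>) \<in> borel_measurable (circle_measure \<Otimes>\<^sub>M \<sigma>)" for k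
    by measurable
  have eq: "(LINT x|circle_measure. h x * (LINT \<zeta>|\<sigma>. poisson (of_real (rad k) * x) \<zeta>))
    = (LINT \<zeta>|\<sigma>. LINT x|circle_measure. h x * poisson (of_real (rad k) * \<zeta>) x)" for k
  proof -
    have "(LINT x|circle_measure. h x * (LINT \<zeta>|\<sigma>. poisson (of_real (rad k) * x) \<zeta>))
      = (LINT x|circle_measure. LINT \<zeta>|\<sigma>. h x * poisson (of_real (rad k) * x) \<zeta>)" by simp
    also have "\<dots> = (LINT \<zeta>|\<sigma>. LINT x|circle_measure. h x * poisson (of_real (rad k) * x) \<zeta>)"
    proof (rule Fubini_bounded[symmetric, OF circle.finite_measure_axioms \<sigma>(1) meas, where B="B * (2 / (1 - rad k))"])
      fix x \<zeta> assume "x \<in> space circle_measure" "\<zeta> \<in> space \<sigma>"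
      then have x: "cmod x = 1" "cmod \<zeta> = 1" using sp by auto
      then have z: "cmod (of_real (rad k) * x) < 1" "cmod (of_real (rad k) * x) = rad k"
        by (auto intro!: cmod_rad_less simp: norm_mult)
      show "norm (h x * poisson (of_real (rad k) * x) \<zeta>) \<le> B * (2 / (1 - rad k))"
        using mult_mono[OF B[OF x(1)] poisson_le[OF z(1) x(2)]] B[OF x(1)]
          poisson_nonneg[of "of_real (rad k) * x" \<zeta>] z by (simp add: abs_mult)
    qed
    also have "\<dots> = (LINT \<zeta>|\<sigma>. LINT x|circle_measure. h x * poisson (of_real (rad k) * \<zeta>) x)"
      by (intro Bochner_Integration.integral_cong refl) (simp add: sp poisson_rotate)
    finally show ?thesis .
  qed
  show ?thesis unfolding eq
  proof (rule integral_dominated_convergence[where w="\<lambda>_. B"])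
    show "AE \<zeta> in \<sigma>. (\<lambda>k. LINT x|circle_measure. h x * poisson (of_real (rad k) * \<zeta>) x) \<longlonglongrightarrow> h \<zeta>"
      using sp by (intro AE_I2 poisson_approximate_identity h) auto
    show "AE \<zeta> in \<sigma>. norm (LINT x|circle_measure. h x * poisson (of_real (rad k) * \<zeta>) x) \<le> B" for k
      using sp by (intro AE_I2) (auto intro!: poisson_average_bound h B cmod_rad_less)
    show "integrable \<sigma> (\<lambda>_. B)" by (rule finite_measure.integrable_const[OF \<sigma>(1)])
    show "h \<in> borel_measurable \<sigma>" by measurable
    show "(\<lambda>\<zeta>. LINT x|circle_measure. h x * poisson (of_real (rad k) * \<zeta>) x) \<in> borel_measurable \<sigma>" for k
      by measurable
  qed
qed

text \<open>
  Indicators of closed sets are limits of continuous functions, and closed sets form an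
  intersection-stable generator; so they are the sets on which measures are compared.
\<close>

definition circle_closed :: "complex set set" where "circle_closed = {F. closed F \<and> F \<subseteq> sphere 0 1}"

lemma sets_circle_borel_eq_closed: "sets circle_borel = sigma_sets (sphere 0 1) circle_closed"
proof -
  have b: "sets borel = sigma_sets UNIV {F::complex set. closed F}"
    unfolding borel_eq_closed by (rule sets_measure_of) simp
  have "sets circle_borel = (\<inter>) (sphere 0 1) ` sigma_sets UNIV {F::complex set. closed F}"
    unfolding sets_restrict_space b ..
  also have "\<dots> = sigma_sets (sphere 0 1) ((\<inter>) (sphere 0 1) ` {F. closed F})"
    by (rule sigma_sets_Int) (auto simp flip: b)
  also have "(\<inter>) (sphere 0 1) ` {F. closed F} = circle_closed"
    by (auto simp: circle_closed_def image_iff intro!: exI closed_Int)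
  finally show ?thesis .
qed

lemma Int_stable_circle_closed: "Int_stable circle_closed"
  by (auto simp: Int_stable_def circle_closed_def)

lemma circle_closed_sets: "F \<in> circle_closed \<Longrightarrow> F \<in> sets circle_borel"
  unfolding sets_circle_borel_eq_closed by (rule sigma_sets.Basic)

definition bump :: "complex set \<Rightarrow> nat \<Rightarrow> complex \<Rightarrow> real" where
  "bump F j x = max 0 (1 - real j * infdist x F)"

lemma continuous_on_bump: "continuous_on A (bump F j)"
  unfolding bump_def by (intro continuous_intros)

lemma measure_eq_lim_bump:
  assumes \<sigma>: "finite_measure \<sigma>" "sets \<sigma> = sets circle_borel" and F: "F \<in> circle_closed" "F \<noteq> {}"
  shows "(\<lambda>j. LINT x|\<sigma>. bump F j x) \<longlonglongrightarrow> measure \<sigma> F"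
proof -
  note [measurable_cong] = \<sigma>(2)
  have Fs: "F \<in> sets \<sigma>" using circle_closed_sets[OF F(1)] \<sigma>(2) by simp
  have cl: "closed F" using F by (auto simp: circle_closed_def)
  have b [measurable]: "bump F j \<in> borel_measurable circle_borel" for j
    by (rule borel_measurable_circle) (rule continuous_on_bump)
  have "(\<lambda>j. LINT x|\<sigma>. bump F j x) \<longlonglongrightarrow> (LINT x|\<sigma>. indicator F x)"
  proof (rule integral_dominated_convergence[where w="\<lambda>_. 1"])
    show "integrable \<sigma> (\<lambda>_. 1::real)" by (rule finite_measure.integrable_const[OF \<sigma>(1)])
    show "AE x in \<sigma>. norm (bump F j x) \<le> 1" for j
      by (intro AE_I2) (auto simp: bump_def infdist_nonneg)
    show "AE x in \<sigma>. (\<lambda>j. bump F j x) \<longlonglongrightarrow> indicator F x"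
    proof (rule AE_I2)
      fix x
      show "(\<lambda>j. bump F j x) \<longlonglongrightarrow> indicator F x"
      proof (cases "x \<in> F")
        case True then show ?thesis by (simp add: bump_def)
      next
        case False
        then have d: "infdist x F > 0" using cl F(2) by (simp add: infdist_pos_not_in_closed)
        have "\<forall>\<^sub>F j in sequentially. real j > 1 / infdist x F"
          using filterlim_real_sequentially by (simp add: filterlim_at_top_dense)
        then have "\<forall>\<^sub>F j in sequentially. bump F j x = 0"
          by eventually_elim (use d in \<open>simp add: bump_def field_simps\<close>)
        then show ?thesis using False by (simp add: tendsto_eventually)
      qed
    qed
    show "indicator F \<in> borel_measurable \<sigma>" using Fs by simp
  qed measurable
  then show ?thesis using Fs sets.sets_into_space[OF Fs] by (simp add: Int_absorb2)
qed

lemma poisson_integral_unique: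
  assumes \<sigma>: "finite_measure \<sigma>" "sets \<sigma> = sets circle_borel"
    and \<tau>: "finite_measure \<tau>" "sets \<tau> = sets circle_borel"
    and eq: "\<And>z. cmod z < 1 \<Longrightarrow> (LINT \<zeta>|\<sigma>. poisson z \<zeta>) = (LINT \<zeta>|\<tau>. poisson z \<zeta>)"
  shows "\<sigma> = \<tau>"
proof -
  interpret \<sigma>: finite_measure \<sigma> by fact
  interpret \<tau>: finite_measure \<tau> by fact
  have "(LINT \<zeta>|\<sigma>. h \<zeta>) = (LINT \<zeta>|\<tau>. h \<zeta>)" if h: "continuous_on (sphere 0 1) h" for h :: "complex \<Rightarrow> real"
  proof (rule LIMSEQ_unique[OF integral_eq_lim_poisson[OF \<sigma> h]])
    have "(LINT x|circle_measure. h x * (LINT \<zeta>|\<sigma>. poisson (of_real (rad k) * x) \<zeta>))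
      = (LINT x|circle_measure. h x * (LINT \<zeta>|\<tau>. poisson (of_real (rad k) * x) \<zeta>))" for k
      by (intro Bochner_Integration.integral_cong refl) (simp add: eq cmod_rad_less)
    then show "(\<lambda>k. LINT x|circle_measure. h x * (LINT \<zeta>|\<sigma>. poisson (of_real (rad k) * x) \<zeta>))
      \<longlonglongrightarrow> (LINT \<zeta>|\<tau>. h \<zeta>)"
      using integral_eq_lim_poisson[OF \<tau> h] by simp
  qed
  then have eqF: "emeasure \<sigma> F = emeasure \<tau> F" if F: "F \<in> circle_closed" for F
  proof (cases "F = {}")
    case False
    have "measure \<sigma> F = measure \<tau> F"
      using measure_eq_lim_bump[OF \<sigma> F False] measure_eq_lim_bump[OF \<tau> F False] LIMSEQ_unique
        \<open>\<And>h. continuous_on (sphere 0 1) h \<Longrightarrow> _ h\<close> continuous_on_bump by auto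
    then show ?thesis by (simp add: \<sigma>.emeasure_eq_measure \<tau>.emeasure_eq_measure)
  qed simp
  have "sphere 0 1 \<in> circle_closed" by (simp add: circle_closed_def)
  then show ?thesis
    by (intro measure_eqI_generator_eq[OF Int_stable_circle_closed, of "sphere 0 1" _ _ "\<lambda>_. sphere 0 1"])
      (auto simp: eqF \<sigma>(2) \<tau>(2) sets_circle_borel_eq_closed circle_closed_def)
qed

text \<open>
  Makes Clark measures, which are not explicit, a measurable kernel: the integral of a continuous
  function is a limit of averages of Poisson integrals, and only these have to be measurable.
\<close>

lemma measurable_poisson_kernel:
  assumes K: "\<And>a. a \<in> space M \<Longrightarrow> prob_space (K a)" "\<And>a. a \<in> space M \<Longrightarrow> sets (K a) = sets circle_borel"
    and u: "\<And>k. (\<lambda>(a, x). u a (of_real (rad k) * x)) \<in> borel_measurable (M \<Otimes>\<^sub>M circle_borel)"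
    and eq: "\<And>a z. a \<in> space M \<Longrightarrow> cmod z < 1 \<Longrightarrow> (LINT \<zeta>|K a. poisson z \<zeta>) = u a z"
  shows "K \<in> measurable M (prob_algebra circle_borel)"
proof (rule measurable_prob_algebra_generated[OF sets_circle_borel_eq_closed Int_stable_circle_closed _ K])
  show "circle_closed \<subseteq> Pow (sphere 0 1)" by (auto simp: circle_closed_def)
  have m: "(\<lambda>a. LINT x|K a. h x) \<in> borel_measurable M" if h: "continuous_on (sphere 0 1) h" for h :: "complex \<Rightarrow> real"
  proof (rule borel_measurable_LIMSEQ_real)
    have [measurable]: "h \<in> borel_measurable circle_borel" by (rule borel_measurable_circle[OF h])
    note u[measurable]
    show "(\<lambda>a. LINT x|circle_measure. h x * u a (of_real (rad k) * x)) \<in> borel_measurable M" for k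
      by measurable
    fix a assume a: "a \<in> space M"
    have "(LINT x|circle_measure. h x * u a (of_real (rad k) * x))
      = (LINT x|circle_measure. h x * (LINT \<zeta>|K a. poisson (of_real (rad k) * x) \<zeta>))" for k
      by (intro Bochner_Integration.integral_cong refl) (simp add: eq a cmod_rad_less)
    then show "(\<lambda>k. LINT x|circle_measure. h x * u a (of_real (rad k) * x)) \<longlonglongrightarrow> (LINT x|K a. h x)"
      using integral_eq_lim_poisson[OF _ K(2)[OF a] h] K(1)[OF a] by (simp add: prob_space.finite_measure)
  qed
  fix F assume F: "F \<in> circle_closed"
  show "(\<lambda>a. emeasure (K a) F) \<in> borel_measurable M"
  proof (cases "F = {}")
    case False
    have "(\<lambda>a. measure (K a) F) \<in> borel_measurable M"
    proof (rule borel_measurable_LIMSEQ_real[where u="\<lambda>j a. LINT x|K a. bump F j x"])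
      show "(\<lambda>a. LINT x|K a. bump F j x) \<in> borel_measurable M" for j
        by (rule m[OF continuous_on_bump])
      show "(\<lambda>j. LINT x|K a. bump F j x) \<longlonglongrightarrow> measure (K a) F" if "a \<in> space M" for a
        using measure_eq_lim_bump[OF prob_space.finite_measure[OF K(1)[OF that]] K(2)[OF that] F False] .
    qed
    then have "(\<lambda>a. ennreal (measure (K a) F)) \<in> borel_measurable M" by measurable
    moreover have "emeasure (K a) F = ennreal (measure (K a) F)" if "a \<in> space M" for a
      using finite_measure.emeasure_eq_measure[OF prob_space.finite_measure[OF K(1)[OF that]]] .
    ultimately show ?thesis by (simp cong: measurable_cong)
  qed simp
qed

section \<open>The Herglotz representation\<close>

lemma circle_integral_eq_uniform:
  fixes g :: "complex \<Rightarrow> 'b::{banach, second_countable_topology}"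
  assumes "g \<in> borel_measurable circle_borel"
  shows "(LINT \<zeta>|circle_measure. g \<zeta>) = (LINT t|uniform_measure lborel {0..<2*pi}. g (cis t))"
  unfolding circle_measure_def by (rule integral_distr) (use assms in auto)

lemma continuous_on_radial:
  assumes "f holomorphic_on ball 0 1"
  shows "continuous_on (cball 0 1) (\<lambda>x. f (of_real (rad k) * x))"
    and "(\<lambda>x. f (of_real (rad k) * x)) holomorphic_on ball 0 1"
proof -
  show "continuous_on (cball 0 1) (\<lambda>x. f (of_real (rad k) * x))"
    by (rule continuous_on_compose2[OF holomorphic_on_imp_continuous_on[OF assms]])
      (auto intro!: continuous_intros cmod_rad_less)
  have "(f \<circ> (\<lambda>x. of_real (rad k) * x)) holomorphic_on ball 0 1"
    by (intro holomorphic_on_compose_gen[OF _ assms] holomorphic_intros)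
      (use cmod_rad_less in \<open>fastforce simp: less_imp_le\<close>)
  then show "(\<lambda>x. f (of_real (rad k) * x)) holomorphic_on ball 0 1" by (simp add: o_def)
qed

lemma poisson_formula_radial:
  assumes "f holomorphic_on ball 0 1" "cmod z < 1"
  shows "(LINT \<zeta>|circle_measure. poisson z \<zeta> *\<^sub>R f (of_real (rad k) * \<zeta>)) = f (of_real (rad k) * z)"
  by (rule poisson_formula[of "\<lambda>x. f (of_real (rad k) * x)", OF continuous_on_radial[OF assms(1)] assms(2)])

text \<open>
  The functions \<open>Re f(r x)\<close> are densities of probability measures for \<open>r < 1\<close>. Transported to the
  line by the angle, they live on one bounded interval, hence are tight, and Helly's selection
  theorem provides a weak limit. The Poisson formula identifies its Poisson integral as \<open>Re f\<close>.
\<close>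

lemma herglotz_representation:
  assumes f: "f holomorphic_on ball 0 1" and Re: "\<And>z. cmod z < 1 \<Longrightarrow> 0 \<le> Re (f z)" and f0: "f 0 = 1"
  shows "\<exists>\<sigma>. prob_space \<sigma> \<and> sets \<sigma> = sets circle_borel \<and>
    (\<forall>z. cmod z < 1 \<longrightarrow> (LINT \<zeta>|\<sigma>. poisson z \<zeta>) = Re (f z))"
proof -
  let ?U = "uniform_measure lborel {0..<2*pi}"
  interpret U: prob_space ?U by (rule prob_space_uniform_law)
  define v where "v k x = Re (f (of_real (rad k) * x))" for k x
  have v0: "v k x \<ge> 0" if "cmod x = 1" for k x
    unfolding v_def using that by (intro Re cmod_rad_less) auto
  have cf: "continuous_on (sphere 0 1) (\<lambda>x. f (of_real (rad k) * x))" for k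
    by (rule continuous_on_subset[OF continuous_on_radial(1)[OF f]]) auto
  then have cv: "continuous_on (sphere 0 1) (v k)" for k
    unfolding v_def by (rule continuous_on_Re)
  have vm [measurable]: "v k \<in> borel_measurable circle_borel" for k
    by (rule borel_measurable_circle[OF cv])
  define N where "N k = density ?U (\<lambda>t. ennreal (v k (cis t)))" for k
  have vP: "(LINT t|?U. v k (cis t) * poisson z (cis t)) = Re (f (of_real (rad k) * z))" if z: "cmod z < 1" for k z
  proof -
    have "(LINT t|?U. v k (cis t) * poisson z (cis t)) = (LINT x|circle_measure. v k x * poisson z x)"
      by (rule circle_integral_eq_uniform[symmetric]) measurable
    also have "\<dots> = Re (LINT x|circle_measure. poisson z x *\<^sub>R f (of_real (rad k) * x))"
    proof -
      have "integrable circle_measure (\<lambda>x. poisson z x *\<^sub>R f (of_real (rad k) * x))"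
        by (intro integrable_circle_continuous[OF circle.finite_measure_axioms sets_circle_measure]
          continuous_on_scaleR continuous_on_poisson_circle z cf)
      from integral_Re[OF this] show ?thesis by (simp add: v_def mult.commute)
    qed
    finally show ?thesis by (simp add: poisson_formula_radial f z)
  qed
  have N: "real_distribution (N k)" for k
  proof -
    have "emeasure (N k) (space (N k)) = (\<integral>\<^sup>+t. ennreal (v k (cis t)) \<partial>?U)"
      by (simp add: N_def emeasure_density)
    also have "\<dots> = ennreal (LINT t|?U. v k (cis t))"
    proof (rule nn_integral_eq_integral)
      have "integrable circle_measure (v k)"
        by (rule integrable_circle_continuous[OF circle.finite_measure_axioms sets_circle_measure cv])
      then show "integrable ?U (\<lambda>t. v k (cis t))"
        unfolding circle_measure_def by (subst (asm) integrable_distr_eq) auto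
    qed (simp add: v0)
    also have "(LINT t|?U. v k (cis t)) = 1"
      using vP[of 0 k] by (simp add: poisson_def f0)
    finally have "prob_space (N k)" by (intro prob_spaceI) simp
    then show ?thesis by (simp add: real_distribution_def real_distribution_axioms_def N_def)
  qed
  \<comment> \<open>All mass lies at angles in \<open>[0, 2 \<pi>)\<close>; half-open intervals exclude their left end, hence \<open>-1\<close>.\<close>
  have "tight N"
    unfolding tight_def
  proof (intro conjI allI impI N)
    fix e :: real assume "e > 0"
    have "measure (N k) {-1<..2*pi} > 1 - e" for k
    proof -
      interpret real_distribution "N k" by (rule N)
      have "AE t in ?U. t \<in> {0..<2*pi}"
        by (rule AE_uniform_measureI) auto
      then have "AE t in N k. t \<in> {-1<..2*pi}"
        unfolding N_def by (subst AE_density) auto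
      then have "prob {-1<..2*pi} = 1" by (subst prob_eq_1) auto
      then show ?thesis using \<open>e > 0\<close> by simp
    qed
    then show "\<exists>a b. a < b \<and> (\<forall>k. 1 - e < measure (N k) {a<..b})"
      by (intro exI[of _ "-1"] exI[of _ "2*pi"]) (auto intro: less_trans[of _ 0])
  qed
  from tight_imp_convergent_subsubsequence[OF this strict_mono_id] obtain r L where
    r: "strict_mono (r :: nat \<Rightarrow> nat)" and L: "real_distribution L" and conv: "weak_conv_m (N \<circ> id \<circ> r) L"
    by blast
  interpret L: real_distribution L by (rule L)
  define \<sigma> where "\<sigma> = distr L circle_borel cis"
  have "prob_space \<sigma>" unfolding \<sigma>_def by (rule L.prob_space_distr) simp
  moreover have "sets \<sigma> = sets circle_borel" by (simp add: \<sigma>_def)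
  moreover have "(LINT \<zeta>|\<sigma>. poisson z \<zeta>) = Re (f z)" if z: "cmod z < 1" for z
  proof (rule LIMSEQ_unique)
    have N': "real_distribution ((N \<circ> id \<circ> r) k)" for k using N by simp
    have "(\<lambda>k. LINT t|(N \<circ> id \<circ> r) k. poisson z (cis t)) \<longlonglongrightarrow> (LINT t|L. poisson z (cis t))"
    proof (rule weak_conv_imp_integral_bdd_continuous_conv[OF N' L conv])
      show "norm (poisson z (cis t)) \<le> 2 / (1 - cmod z)" for t
        using poisson_le[OF z, of "cis t"] poisson_nonneg[of z] z by simp
      have "continuous_on UNIV (\<lambda>t. poisson z (cis t))"
        using z by (intro continuous_intros) auto
      then show "isCont (\<lambda>t. poisson z (cis t)) t" for t
        by (simp add: continuous_on_eq_continuous_at)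
    qed
    also have "(LINT t|L. poisson z (cis t)) = (LINT \<zeta>|\<sigma>. poisson z \<zeta>)"
      unfolding \<sigma>_def by (rule integral_distr[symmetric]) measurable
    also have "(\<lambda>k. LINT t|(N \<circ> id \<circ> r) k. poisson z (cis t)) = (\<lambda>k. Re (f (of_real (rad (r k)) * z)))"
    proof
      fix k
      have "(LINT t|N (r k). poisson z (cis t)) = (LINT t|?U. v (r k) (cis t) *\<^sub>R poisson z (cis t))"
        unfolding N_def by (rule integral_density) (auto simp: v0)
      then show "(LINT t|(N \<circ> id \<circ> r) k. poisson z (cis t)) = Re (f (of_real (rad (r k)) * z))"
        using vP[OF z] by simp
    qed
    finally show "(\<lambda>k. Re (f (of_real (rad (r k)) * z))) \<longlonglongrightarrow> (LINT \<zeta>|\<sigma>. poisson z \<zeta>)" .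
    have "isCont f z"
      using holomorphic_on_imp_continuous_on[OF f] z
      unfolding continuous_on_eq_continuous_at[OF open_ball] by simp
    moreover have "(\<lambda>k. of_real (rad (r k)) * z) \<longlonglongrightarrow> of_real 1 * z"
      by (intro tendsto_intros) (use LIMSEQ_subseq_LIMSEQ[OF tendsto_rad r] in \<open>simp add: o_def\<close>)
    ultimately show "(\<lambda>k. Re (f (of_real (rad (r k)) * z))) \<longlonglongrightarrow> Re (f z)"
      by (intro tendsto_Re isCont_tendsto_compose[of _ f]) auto
  qed
  ultimately show ?thesis by blast
qed

section \<open>Clark measures and their average over the parameter\<close>

locale disc_self_map =
  fixes \<phi> :: "complex \<Rightarrow> complex"
  assumes holomorphic: "\<phi> holomorphic_on ball 0 1"
    and self_map: "\<And>z. cmod z < 1 \<Longrightarrow> cmod (\<phi> z) < 1"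
    and zero: "\<phi> 0 = 0"
begin

abbreviation clark :: "complex \<Rightarrow> complex measure" where "clark \<equiv> clark_measure \<phi>"

text \<open>
  For unimodular \<open>\<alpha>\<close>, the real part of \<open>(\<alpha> + w) / (\<alpha> - w)\<close> is the Poisson kernel at \<open>(w, \<alpha>)\<close>.
\<close>

lemma clark_exists:
  assumes \<alpha>: "cmod \<alpha> = 1"
  shows "\<exists>\<sigma>. prob_space \<sigma> \<and> sets \<sigma> = sets circle_borel \<and>
    (\<forall>z. cmod z < 1 \<longrightarrow> (LINT \<zeta>|\<sigma>. poisson z \<zeta>) = poisson (\<phi> z) \<alpha>)"
proof -
  define f where "f z = (\<alpha> + \<phi> z) / (\<alpha> - \<phi> z)" for z
  have "\<exists>\<sigma>. prob_space \<sigma> \<and> sets \<sigma> = sets circle_borel \<and>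
      (\<forall>z. cmod z < 1 \<longrightarrow> (LINT \<zeta>|\<sigma>. poisson z \<zeta>) = Re (f z))"
  proof (rule herglotz_representation)
    show "f holomorphic_on ball 0 1"
      unfolding f_def using self_map \<alpha> by (intro holomorphic_intros holomorphic) force
    show "0 \<le> Re (f z)" if "cmod z < 1" for z
      using poisson_nonneg[of "\<phi> z" \<alpha>] self_map[OF that] by (simp add: f_def poisson_eq_Re \<alpha>)
    show "f 0 = 1" using \<alpha> by (auto simp: f_def zero)
  qed
  then show ?thesis by (simp add: f_def poisson_eq_Re \<alpha>)
qed

lemma clark_measure:
  assumes \<alpha>: "cmod \<alpha> = 1"
  shows prob_space_clark: "prob_space (clark \<alpha>)"
    and sets_clark: "sets (clark \<alpha>) = sets circle_borel"
    and poisson_clark: "\<And>z. cmod z < 1 \<Longrightarrow> (LINT \<zeta>|clark \<alpha>. poisson z \<zeta>) = poisson (\<phi> z) \<alpha>"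
proof -
  obtain \<sigma> where \<sigma>: "prob_space \<sigma>" "sets \<sigma> = sets circle_borel"
    "\<And>z. cmod z < 1 \<Longrightarrow> (LINT \<zeta>|\<sigma>. poisson z \<zeta>) = poisson (\<phi> z) \<alpha>"
    using clark_exists[OF \<alpha>] by blast
  have "clark \<alpha> = \<sigma>"
    unfolding clark_measure_def
  proof (rule the_equality)
    show "is_clark_measure \<phi> \<alpha> \<sigma>"
      using \<sigma> by (simp add: is_clark_measure_def prob_space.finite_measure poisson_eq_Re[OF \<alpha>, symmetric]
          poisson_def[symmetric])
    fix \<tau> assume "is_clark_measure \<phi> \<alpha> \<tau>"
    then show "\<tau> = \<sigma>"
      using \<sigma> by (intro poisson_integral_unique)
        (auto simp: is_clark_measure_def prob_space.finite_measure poisson_eq_Re[OF \<alpha>, symmetric] poisson_def[symmetric])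
  qed
  with \<sigma> show "prob_space (clark \<alpha>)" "sets (clark \<alpha>) = sets circle_borel"
    "\<And>z. cmod z < 1 \<Longrightarrow> (LINT \<zeta>|clark \<alpha>. poisson z \<zeta>) = poisson (\<phi> z) \<alpha>" by auto
qed

lemma space_clark: "cmod \<alpha> = 1 \<Longrightarrow> space (clark \<alpha>) = sphere 0 1"
  using sets_eq_imp_space_eq[OF sets_clark] by simp

lemma finite_measure_clark: "cmod \<alpha> = 1 \<Longrightarrow> finite_measure (clark \<alpha>)"
  by (rule prob_space.finite_measure[OF prob_space_clark])

lemma measurable_radial [measurable]: "(\<lambda>x. \<phi> (of_real (rad k) * x)) \<in> borel_measurable circle_borel"
  by (rule borel_measurable_circle) (rule continuous_on_subset[OF continuous_on_radial(1)[OF holomorphic]], auto)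

lemma measurable_clark_prob: "clark \<in> measurable circle_measure (prob_algebra circle_borel)"
proof (rule measurable_poisson_kernel[where u="\<lambda>a z. poisson (\<phi> z) a"])
  show "(\<lambda>(a, x). poisson (\<phi> (of_real (rad k) * x)) a) \<in> borel_measurable (circle_measure \<Otimes>\<^sub>M circle_borel)" for k
    by measurable
qed (auto simp: prob_space_clark sets_clark poisson_clark)

lemma measurable_clark [measurable]: "clark \<in> measurable circle_measure (subprob_algebra circle_borel)"
  by (rule measurable_prob_algebraD[OF measurable_clark_prob])

text \<open>
  Both sides have Poisson integral \<open>1\<close>: for the left one this is the mean over \<open>\<alpha>\<close> of the Poisson
  kernel at \<open>(\<phi> z, \<alpha>)\<close>.
\<close>

lemma average_clark: "circle_measure \<bind> clark = circle_measure"
proof -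
  have sb: "sets (circle_measure \<bind> clark) = sets circle_borel"
    by (rule sets_bind) (auto simp: sets_clark)
  have pb: "prob_space (circle_measure \<bind> clark)"
    by (rule circle.prob_space_bind[OF _ measurable_clark]) (auto simp: prob_space_clark)
  show ?thesis
  proof (rule poisson_integral_unique[OF prob_space.finite_measure[OF pb] sb circle.finite_measure_axioms sets_circle_measure])
    fix z :: complex assume z: "cmod z < 1"
    have w: "cmod (\<phi> z) < 1" by (rule self_map[OF z])
    have nn: "(\<integral>\<^sup>+x. ennreal (poisson z x) \<partial>\<sigma>) = ennreal (LINT x|\<sigma>. poisson z x)"
      if "finite_measure \<sigma>" "sets \<sigma> = sets circle_borel" "cmod z < 1" for \<sigma> z
      using that by (intro nn_integral_eq_integral integrable_poisson) (auto simp: poisson_nonneg)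
    have [measurable]: "poisson z \<in> borel_measurable circle_borel"
      using measurable_poisson[of "\<lambda>_. z" circle_borel "\<lambda>x. x"] by simp
    have "(\<integral>\<^sup>+x. ennreal (poisson z x) \<partial>(circle_measure \<bind> clark))
      = (\<integral>\<^sup>+\<alpha>. \<integral>\<^sup>+x. ennreal (poisson z x) \<partial>clark \<alpha> \<partial>circle_measure)"
      by (rule nn_integral_bind[where B=circle_borel]) measurable
    also have "\<dots> = (\<integral>\<^sup>+\<alpha>. ennreal (poisson (\<phi> z) \<alpha>) \<partial>circle_measure)"
      by (intro nn_integral_cong) (simp add: nn finite_measure_clark sets_clark poisson_clark z)
    also have "\<dots> = ennreal 1"
      by (simp add: nn circle.finite_measure_axioms w integral_poisson)
    also have "\<dots> = ennreal (LINT x|circle_measure. poisson z x)" using integral_poisson[OF z] by simp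
    finally show "(LINT x|(circle_measure \<bind> clark). poisson z x) = (LINT x|circle_measure. poisson z x)"
      unfolding nn[OF prob_space.finite_measure[OF pb] sb z]
      by (subst (asm) ennreal_inj) (auto intro!: integral_nonneg_AE simp: poisson_nonneg z less_imp_le)
  qed
qed

text \<open>
  In this form, \<open>average_clark\<close> turns a property of almost every point into one of almost every
  Clark measure.
\<close>

lemma AE_clark:
  assumes "AE x in circle_measure. P x"
  shows "AE \<alpha> in circle_measure. AE x in clark \<alpha>. P x"
proof -
  obtain N where N: "\<And>x. x \<in> space circle_measure - N \<Longrightarrow> P x" "N \<in> null_sets circle_measure"
    using AE_E3[OF assms] by blast
  then have [measurable]: "N \<in> sets circle_borel" by auto
  have "AE x in circle_measure \<bind> clark. x \<notin> N"
    unfolding average_clark by (rule AE_not_in[OF N(2)])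
  then have ae: "AE \<alpha> in circle_measure. AE x in clark \<alpha>. x \<notin> N"
    by (subst (asm) AE_bind[OF measurable_clark]) auto
  show ?thesis
  proof (rule AE_mp[OF ae], rule AE_I2, rule impI)
    fix \<alpha> assume \<alpha>: "\<alpha> \<in> space circle_measure" "AE x in clark \<alpha>. x \<notin> N"
    show "AE x in clark \<alpha>. P x"
    proof (rule AE_mp[OF \<alpha>(2)], intro AE_I2 impI)
      show "P x" if "x \<in> space (clark \<alpha>)" "x \<notin> N" for x
        using N(1)[of x] that \<alpha>(1) by (simp add: space_clark)
    qed
  qed
qed

lemma poisson_radial_le:
  assumes "cmod \<alpha> = 1" "cmod x = 1"
  shows "poisson (\<phi> (of_real (rad k) * x)) \<alpha> \<le> 2 / (1 - rad k)"
proof -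
  let ?z = "of_real (rad k) * x"
  interpret prob_space "clark \<alpha>" by (rule prob_space_clark[OF assms(1)])
  have z: "cmod ?z < 1" "cmod ?z = rad k" using assms by (auto intro!: cmod_rad_less simp: norm_mult)
  have "poisson (\<phi> ?z) \<alpha> = (LINT \<zeta>|clark \<alpha>. poisson ?z \<zeta>)"
    using poisson_clark[OF assms(1) z(1)] by simp
  also have "\<dots> \<le> (LINT \<zeta>|clark \<alpha>. 2 / (1 - rad k))"
    by (intro integral_mono integrable_poisson finite_measure_axioms sets_clark assms z)
      (use poisson_le[OF z(1)] z(2) assms in \<open>auto simp: space_clark\<close>)
  finally show ?thesis by (simp add: prob_space)
qed

text \<open>
  The function \<open>x \<mapsto> \<phi>(r (r x))\<close> is a Poisson average of the values \<open>\<phi>(r y)\<close>; by symmetry of the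
  kernel the average can be applied to the measure instead, whose Poisson integral is known. The
  dilation by \<open>r\<^sup>2\<close> on one side and \<open>r\<close> on the other makes the identity exact, without a limit.
\<close>

lemma integral_clark_radial:
  assumes \<alpha>: "cmod \<alpha> = 1"
  shows "(LINT x|clark \<alpha>. \<phi> (of_real (rad k) * (of_real (rad k) * x)))
    = (LINT y|circle_measure. poisson (\<phi> (of_real (rad k) * y)) \<alpha> *\<^sub>R \<phi> (of_real (rad k) * y))"
proof -
  note [measurable_cong] = sets_clark[OF \<alpha>]
  let ?F = "\<lambda>x y. poisson (of_real (rad k) * x) y *\<^sub>R \<phi> (of_real (rad k) * y)"
  have "(LINT x|clark \<alpha>. \<phi> (of_real (rad k) * (of_real (rad k) * x)))
      = (LINT x|clark \<alpha>. LINT y|circle_measure. ?F x y)"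
    by (intro Bochner_Integration.integral_cong refl)
      (simp add: poisson_formula_radial holomorphic cmod_rad_less space_clark \<alpha>)
  also have "\<dots> = (LINT y|circle_measure. LINT x|clark \<alpha>. ?F x y)"
  proof (rule Fubini_bounded[symmetric, OF finite_measure_clark[OF \<alpha>] circle.finite_measure_axioms, where B="2 / (1 - rad k)"])
    show "case_prod ?F \<in> borel_measurable (clark \<alpha> \<Otimes>\<^sub>M circle_measure)" by measurable
    fix x y assume "x \<in> space (clark \<alpha>)" "y \<in> space circle_measure"
    then have xy: "cmod x = 1" "cmod y = 1" by (auto simp: space_clark \<alpha>)
    then have z: "cmod (of_real (rad k) * x) < 1" "cmod (of_real (rad k) * x) = rad k"
      "cmod (of_real (rad k) * y) < 1"
      by (auto intro!: cmod_rad_less simp: norm_mult)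
    have "poisson (of_real (rad k) * x) y * cmod (\<phi> (of_real (rad k) * y)) \<le> 2 / (1 - rad k) * 1"
      using poisson_le[OF z(1) xy(2)] self_map[OF z(3)] z(2) by (intro mult_mono) auto
    then show "norm (?F x y) \<le> 2 / (1 - rad k)"
      using poisson_nonneg[of "of_real (rad k) * x" y] z by simp
  qed
  also have "\<dots> = (LINT y|circle_measure. (LINT x|clark \<alpha>. poisson (of_real (rad k) * y) x) *\<^sub>R \<phi> (of_real (rad k) * y))"
  proof (rule Bochner_Integration.integral_cong[OF refl])
    fix y assume "y \<in> space circle_measure"
    then have y: "cmod y = 1" by simp
    then have z: "cmod (of_real (rad k) * y) < 1" by (simp add: cmod_rad_less)
    have "(LINT x|clark \<alpha>. ?F x y) = (LINT x|clark \<alpha>. poisson (of_real (rad k) * y) x *\<^sub>R \<phi> (of_real (rad k) * y))"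
      by (intro Bochner_Integration.integral_cong refl) (simp add: space_clark \<alpha> y poisson_rotate)
    also have "\<dots> = (LINT x|clark \<alpha>. poisson (of_real (rad k) * y) x) *\<^sub>R \<phi> (of_real (rad k) * y)"
      by (rule integral_scaleR_left) (intro integrable_poisson finite_measure_clark sets_clark \<alpha> z)
    finally show "(LINT x|clark \<alpha>. ?F x y) = (LINT x|clark \<alpha>. poisson (of_real (rad k) * y) x) *\<^sub>R \<phi> (of_real (rad k) * y)" .
  qed
  also have "\<dots> = (LINT y|circle_measure. poisson (\<phi> (of_real (rad k) * y)) \<alpha> *\<^sub>R \<phi> (of_real (rad k) * y))"
    by (intro Bochner_Integration.integral_cong refl) (simp add: poisson_clark \<alpha> cmod_rad_less)
  finally show ?thesis .
qed

lemma integrable_norm_radial: "integrable circle_measure (\<lambda>y. (cmod (\<phi> (of_real (rad k) * y)))\<^sup>2)"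
  by (rule circle.integrable_const_bound[of _ 1])
    (auto intro!: AE_I2 power_le_one less_imp_le[OF self_map] cmod_rad_less)

text \<open>
  After exchanging the integrals, the mean over \<open>\<alpha>\<close> of \<open>cnj \<alpha>\<close> against the Poisson kernel at
  \<open>(w, \<alpha>)\<close> is \<open>cnj w\<close>.
\<close>

lemma average_clark_radial:
  "(LINT \<alpha>|circle_measure. Re (cnj \<alpha> * (LINT x|clark \<alpha>. \<phi> (of_real (rad k) * (of_real (rad k) * x)))))
    = (LINT y|circle_measure. (cmod (\<phi> (of_real (rad k) * y)))\<^sup>2)"
proof -
  let ?w = "\<lambda>y. \<phi> (of_real (rad k) * y)"
  have wlt: "cmod (?w y) < 1" if "cmod y = 1" for y
    using that by (intro self_map cmod_rad_less) auto
  have bound: "poisson (?w y) \<alpha> * (cmod \<alpha> * cmod (?w y)) \<le> 2 / (1 - rad k)" if "cmod y = 1" "cmod \<alpha> = 1" for y \<alpha>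
    using mult_mono[OF poisson_radial_le[OF that(2,1), of k] less_imp_le[OF wlt[OF that(1)]]] that by simp
  have "(LINT \<alpha>|circle_measure. Re (cnj \<alpha> * (LINT x|clark \<alpha>. \<phi> (of_real (rad k) * (of_real (rad k) * x)))))
      = (LINT \<alpha>|circle_measure. LINT y|circle_measure. poisson (?w y) \<alpha> * Re (cnj \<alpha> * ?w y))"
  proof (rule Bochner_Integration.integral_cong[OF refl])
    fix \<alpha> assume "\<alpha> \<in> space circle_measure"
    then have \<alpha>: "cmod \<alpha> = 1" by simp
    have int: "integrable circle_measure (\<lambda>y. cnj \<alpha> * (poisson (?w y) \<alpha> *\<^sub>R ?w y))"
    proof (rule circle.integrable_const_bound[of _ "2 / (1 - rad k)"])
      show "AE y in circle_measure. norm (cnj \<alpha> * (poisson (?w y) \<alpha> *\<^sub>R ?w y)) \<le> 2 / (1 - rad k)"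
        using bound[OF _ \<alpha>] wlt
        by (intro AE_I2) (simp add: norm_mult \<alpha> poisson_nonneg less_imp_le)
    qed measurable
    have "cnj \<alpha> * (LINT x|clark \<alpha>. \<phi> (of_real (rad k) * (of_real (rad k) * x)))
        = (LINT y|circle_measure. cnj \<alpha> * (poisson (?w y) \<alpha> *\<^sub>R ?w y))"
      unfolding integral_clark_radial[OF \<alpha>] by (rule Bochner_Integration.integral_mult_right_zero[symmetric])
    then have "Re (cnj \<alpha> * (LINT x|clark \<alpha>. \<phi> (of_real (rad k) * (of_real (rad k) * x))))
        = (LINT y|circle_measure. Re (cnj \<alpha> * (poisson (?w y) \<alpha> *\<^sub>R ?w y)))"
      unfolding integral_Re[OF int] by simp
    also have "\<dots> = (LINT y|circle_measure. poisson (?w y) \<alpha> * Re (cnj \<alpha> * ?w y))"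
      by (intro Bochner_Integration.integral_cong refl) (simp add: algebra_simps)
    finally show "Re (cnj \<alpha> * (LINT x|clark \<alpha>. \<phi> (of_real (rad k) * (of_real (rad k) * x)))) = \<dots>" .
  qed
  also have "\<dots> = (LINT y|circle_measure. LINT \<alpha>|circle_measure. poisson (?w y) \<alpha> * Re (cnj \<alpha> * ?w y))"
  proof (rule Fubini_bounded[OF circle.finite_measure_axioms circle.finite_measure_axioms, where B="2 / (1 - rad k)"])
    show "(\<lambda>(y, \<alpha>). poisson (?w y) \<alpha> * Re (cnj \<alpha> * ?w y)) \<in> borel_measurable (circle_measure \<Otimes>\<^sub>M circle_measure)"
      by measurable
    fix y \<alpha> assume "y \<in> space circle_measure" "\<alpha> \<in> space circle_measure"
    then have y: "cmod y = 1" and \<alpha>: "cmod \<alpha> = 1" by auto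
    have "\<bar>Re (cnj \<alpha> * ?w y)\<bar> \<le> cmod \<alpha> * cmod (?w y)"
      using abs_Re_le_cmod[of "cnj \<alpha> * ?w y"] by (simp add: norm_mult)
    then have "poisson (?w y) \<alpha> * \<bar>Re (cnj \<alpha> * ?w y)\<bar> \<le> poisson (?w y) \<alpha> * (cmod \<alpha> * cmod (?w y))"
      using wlt[OF y] by (intro mult_left_mono) (auto simp: poisson_nonneg less_imp_le)
    then show "norm (poisson (?w y) \<alpha> * Re (cnj \<alpha> * ?w y)) \<le> 2 / (1 - rad k)"
      using bound[OF y \<alpha>] poisson_nonneg[of "?w y" \<alpha>] wlt[OF y] by (simp add: abs_mult)
  qed
  also have "\<dots> = (LINT y|circle_measure. (cmod (?w y))\<^sup>2)"
  proof (rule Bochner_Integration.integral_cong[OF refl])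
    fix y assume "y \<in> space circle_measure"
    then have w: "cmod (?w y) < 1" by (intro wlt) simp
    have int: "integrable circle_measure (\<lambda>\<alpha>. cnj (?w y) * (poisson (?w y) \<alpha> *\<^sub>R \<alpha>))"
      by (intro integrable_circle_continuous[OF circle.finite_measure_axioms sets_circle_measure]
          continuous_intros continuous_on_poisson_circle w)
    have "(LINT \<alpha>|circle_measure. poisson (?w y) \<alpha> * Re (cnj \<alpha> * ?w y))
        = (LINT \<alpha>|circle_measure. Re (cnj (?w y) * (poisson (?w y) \<alpha> *\<^sub>R \<alpha>)))"
      by (intro Bochner_Integration.integral_cong refl) (simp add: algebra_simps)
    also have "\<dots> = Re (cnj (?w y) * (LINT \<alpha>|circle_measure. poisson (?w y) \<alpha> *\<^sub>R \<alpha>))"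
      unfolding integral_Re[OF int] by (simp only: Bochner_Integration.integral_mult_right_zero)
    also have "\<dots> = (cmod (?w y))\<^sup>2"
      unfolding integral_poisson_ident[OF w] cmod_power2 by (simp add: power2_eq_square)
    finally show "(LINT \<alpha>|circle_measure. poisson (?w y) \<alpha> * Re (cnj \<alpha> * ?w y)) = (cmod (?w y))\<^sup>2" .
  qed
  finally show ?thesis .
qed

text \<open>
  Expand the square, using \<open>\<bar>\<alpha>\<bar> = 1\<close> and \<open>\<bar>\<phi>\<bar> \<le> 1\<close>; the mixed term is \<open>average_clark_radial\<close>.
\<close>

lemma clark_L2_distance:
  "(\<integral>\<^sup>+\<alpha>. \<integral>\<^sup>+x. ennreal ((cmod (\<alpha> - \<phi> (of_real (rad k) * (of_real (rad k) * x))))\<^sup>2) \<partial>clark \<alpha> \<partial>circle_measure)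
    \<le> ennreal (2 - 2 * (LINT y|circle_measure. (cmod (\<phi> (of_real (rad k) * y)))\<^sup>2))"
proof -
  let ?w = "\<lambda>x. \<phi> (of_real (rad k) * (of_real (rad k) * x))"
  let ?A = "\<lambda>\<alpha>. LINT x|clark \<alpha>. ?w x"
  have wlt: "cmod (?w x) < 1" if "cmod x = 1" for x
    using that by (intro self_map cmod_rad_less less_imp_le[OF cmod_rad_less]) auto
  have wm [measurable]: "?w \<in> borel_measurable circle_borel"
  proof (rule borel_measurable_circle, rule continuous_on_compose2[OF continuous_on_radial(1)[OF holomorphic]])
    show "continuous_on (sphere 0 1) (\<lambda>x::complex. of_real (rad k) * x)" by (intro continuous_intros)
    show "(\<lambda>x::complex. of_real (rad k) * x) ` sphere 0 1 \<subseteq> cball 0 1"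
    proof (rule image_subsetI)
      fix x :: complex assume "x \<in> sphere 0 1"
      then show "of_real (rad k) * x \<in> cball 0 1" using cmod_rad_less[of x k] by simp
    qed
  qed
  have Am: "?A \<in> borel_measurable circle_measure" by measurable
  have inner: "(\<integral>\<^sup>+x. ennreal ((cmod (\<alpha> - ?w x))\<^sup>2) \<partial>clark \<alpha>) \<le> ennreal (2 - 2 * Re (cnj \<alpha> * ?A \<alpha>))"
    and A1: "cmod (?A \<alpha>) \<le> 1" if \<alpha>: "cmod \<alpha> = 1" for \<alpha>
  proof -
    interpret prob_space "clark \<alpha>" by (rule prob_space_clark[OF \<alpha>])
    note [measurable_cong] = sets_clark[OF \<alpha>]
    have iw: "integrable (clark \<alpha>) ?w"
      by (rule integrable_const_bound[of _ 1]) (use wlt \<alpha> in \<open>auto intro!: AE_I2 simp: space_clark less_imp_le\<close>)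
    have "cmod (?A \<alpha>) \<le> (LINT x|clark \<alpha>. cmod (?w x))" by (rule integral_norm_bound)
    also have "\<dots> \<le> (LINT x|clark \<alpha>. 1)"
      using iw wlt \<alpha> by (intro integral_mono integrable_norm) (auto simp: space_clark less_imp_le)
    finally show "cmod (?A \<alpha>) \<le> 1" by (simp add: prob_space)
    have iw': "integrable (clark \<alpha>) (\<lambda>x. cnj \<alpha> * ?w x)" by (rule integrable_mult_right[OF iw])
    have i2: "integrable (clark \<alpha>) (\<lambda>x. 2 - 2 * Re (cnj \<alpha> * ?w x))"
      by (intro Bochner_Integration.integrable_diff integrable_const integrable_mult_right integrable_Re[OF iw'])
    have le: "(cmod (\<alpha> - ?w x))\<^sup>2 \<le> 2 - 2 * Re (cnj \<alpha> * ?w x)" if x: "cmod x = 1" for x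
    proof -
      have "(cmod (\<alpha> - ?w x))\<^sup>2 = (cmod \<alpha>)\<^sup>2 + (cmod (?w x))\<^sup>2 - 2 * Re (cnj \<alpha> * ?w x)"
        unfolding cmod_power2 by (simp add: power2_eq_square algebra_simps)
      moreover have "(cmod (?w x))\<^sup>2 \<le> 1" using wlt[OF x] by (simp add: power_le_one)
      ultimately show ?thesis by (simp add: \<alpha>)
    qed
    have "(\<integral>\<^sup>+x. ennreal ((cmod (\<alpha> - ?w x))\<^sup>2) \<partial>clark \<alpha>) \<le> (\<integral>\<^sup>+x. ennreal (2 - 2 * Re (cnj \<alpha> * ?w x)) \<partial>clark \<alpha>)"
      by (intro nn_integral_mono ennreal_leI le) (simp add: space_clark \<alpha>)
    also have "\<dots> = ennreal (LINT x|clark \<alpha>. 2 - 2 * Re (cnj \<alpha> * ?w x))"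
    proof (rule nn_integral_eq_integral[OF i2], rule AE_I2)
      fix x assume "x \<in> space (clark \<alpha>)"
      then have "cmod x = 1" by (simp add: space_clark \<alpha>)
      from le[OF this] show "0 \<le> 2 - 2 * Re (cnj \<alpha> * ?w x)"
        using zero_le_power2 order_trans by blast
    qed
    also have "(LINT x|clark \<alpha>. 2 - 2 * Re (cnj \<alpha> * ?w x)) = 2 - 2 * (LINT x|clark \<alpha>. Re (cnj \<alpha> * ?w x))"
      by (subst Bochner_Integration.integral_diff[OF integrable_const integrable_mult_right[OF integrable_Re[OF iw']]])
        (simp only: lebesgue_integral_const prob_space scaleR_one Bochner_Integration.integral_mult_right_zero)
    also have "(LINT x|clark \<alpha>. Re (cnj \<alpha> * ?w x)) = Re (cnj \<alpha> * ?A \<alpha>)"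
      unfolding integral_Re[OF iw'] by (simp only: Bochner_Integration.integral_mult_right_zero)
    finally show "(\<integral>\<^sup>+x. ennreal ((cmod (\<alpha> - ?w x))\<^sup>2) \<partial>clark \<alpha>) \<le> ennreal (2 - 2 * Re (cnj \<alpha> * ?A \<alpha>))" .
  qed
  have reA: "\<bar>Re (cnj \<alpha> * ?A \<alpha>)\<bar> \<le> 1" if \<alpha>: "cmod \<alpha> = 1" for \<alpha>
    using abs_Re_le_cmod[of "cnj \<alpha> * ?A \<alpha>"] A1[OF \<alpha>] by (simp add: norm_mult \<alpha>)
  have iA: "integrable circle_measure (\<lambda>\<alpha>. Re (cnj \<alpha> * ?A \<alpha>))"
  proof (rule circle.integrable_const_bound[of _ 1])
    show "(\<lambda>\<alpha>. Re (cnj \<alpha> * ?A \<alpha>)) \<in> borel_measurable circle_measure" using Am by measurable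
  qed (use reA in \<open>auto intro!: AE_I2\<close>)
  have "(\<integral>\<^sup>+\<alpha>. \<integral>\<^sup>+x. ennreal ((cmod (\<alpha> - ?w x))\<^sup>2) \<partial>clark \<alpha> \<partial>circle_measure)
      \<le> (\<integral>\<^sup>+\<alpha>. ennreal (2 - 2 * Re (cnj \<alpha> * ?A \<alpha>)) \<partial>circle_measure)"
    by (intro nn_integral_mono inner) simp
  also have "\<dots> = ennreal (LINT \<alpha>|circle_measure. 2 - 2 * Re (cnj \<alpha> * ?A \<alpha>))"
  proof (rule nn_integral_eq_integral)
    show "integrable circle_measure (\<lambda>\<alpha>. 2 - 2 * Re (cnj \<alpha> * ?A \<alpha>))"
      by (intro Bochner_Integration.integrable_diff circle.integrable_const integrable_mult_right iA)
    show "AE \<alpha> in circle_measure. 0 \<le> 2 - 2 * Re (cnj \<alpha> * ?A \<alpha>)"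
    proof (rule AE_I2)
      fix \<alpha> assume "\<alpha> \<in> space circle_measure"
      then show "0 \<le> 2 - 2 * Re (cnj \<alpha> * ?A \<alpha>)" using reA[of \<alpha>] by (simp only: space_circle_measure mem_sphere_0) linarith
    qed
  qed
  also have "(LINT \<alpha>|circle_measure. 2 - 2 * Re (cnj \<alpha> * ?A \<alpha>)) = 2 - 2 * (LINT \<alpha>|circle_measure. Re (cnj \<alpha> * ?A \<alpha>))"
    by (subst Bochner_Integration.integral_diff[OF circle.integrable_const integrable_mult_right[OF iA]])
      (simp only: lebesgue_integral_const circle.prob_space scaleR_one Bochner_Integration.integral_mult_right_zero)
  finally show ?thesis unfolding average_clark_radial .
qed

end

section \<open>Inner functions: radial limits and singularity\<close>

lemma square_summable_tendsto:
  assumes "(\<Sum>k. ennreal ((cmod (a - w k))\<^sup>2)) \<noteq> \<infinity>"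
  shows "w \<longlonglongrightarrow> a"
proof -
  have "summable (\<lambda>k. (cmod (a - w k))\<^sup>2)"
    by (rule summable_suminf_not_top) (use assms in auto)
  then have "(\<lambda>k. sqrt ((cmod (a - w k))\<^sup>2)) \<longlonglongrightarrow> sqrt 0"
    by (intro tendsto_real_sqrt summable_LIMSEQ_zero)
  then have "(\<lambda>k. cmod (w k - a)) \<longlonglongrightarrow> 0" by (simp add: norm_minus_commute)
  then show ?thesis by (rule LIM_zero_cancel[OF tendsto_norm_zero_cancel])
qed

text \<open>
  For a self-map of the disc, being inner is equivalent to this convergence in mean of \<open>\<bar>\<phi>\<bar>\<^sup>2\<close> on
  circles of radius tending to \<open>1\<close>, a form which does not mention boundary values.
\<close>

locale inner_self_map = disc_self_map +
  assumes inner: "(\<lambda>k. LINT y|circle_measure. (cmod (\<phi> (of_real (rad k) * y)))\<^sup>2) \<longlonglongrightarrow> 1"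
begin

text \<open>
  The radii are chosen so sparse that the bounds in \<open>clark_L2_distance\<close> are summable. The resulting
  series, rather than the convergence \<open>\<phi>(\<rho>\<^sub>k x) \<rightarrow> \<alpha>\<close> that it implies, is kept in the statement since
  it is visibly a measurable function of the pair \<open>(\<alpha>, x)\<close>.
\<close>

lemma clark_carrier:
  obtains \<rho> :: "nat \<Rightarrow> real" where "\<forall>k. 0 < \<rho> k \<and> \<rho> k < 1" "\<rho> \<longlonglongrightarrow> 1"
    "case_prod (\<lambda>\<alpha> x. \<Sum>k. ennreal ((cmod (\<alpha> - \<phi> (of_real (\<rho> k) * x)))\<^sup>2))
      \<in> borel_measurable (circle_measure \<Otimes>\<^sub>M circle_borel)"
    "AE \<alpha> in circle_measure. AE x in clark \<alpha>. (\<Sum>k. ennreal ((cmod (\<alpha> - \<phi> (of_real (\<rho> k) * x)))\<^sup>2)) \<noteq> \<infinity>"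
proof -
  let ?I = "\<lambda>k. LINT y|circle_measure. (cmod (\<phi> (of_real (rad k) * y)))\<^sup>2"
  have "\<exists>n\<ge>k. 2 - 2 * ?I n \<le> (1/2)^k" for k
  proof -
    have "(\<lambda>n. 2 - 2 * ?I n) \<longlonglongrightarrow> 2 - 2 * 1" by (intro tendsto_intros inner)
    then have "\<forall>\<^sub>F n in sequentially. 2 - 2 * ?I n < (1/2)^k"
      by (rule order_tendstoD(2)) simp
    then have "\<forall>\<^sub>F n in sequentially. n \<ge> k \<and> 2 - 2 * ?I n < (1/2)^k"
      by (intro eventually_conj eventually_ge_at_top)
    then obtain n where "n \<ge> k \<and> 2 - 2 * ?I n < (1/2)^k"
      using eventually_happens[of _ sequentially] by fastforce
    then show ?thesis by (intro exI[of _ n]) simp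
  qed
  then obtain s where s: "\<And>k. s k \<ge> k" "\<And>k. 2 - 2 * ?I (s k) \<le> (1/2)^k" by metis
  define \<rho> where "\<rho> k = rad (s k) * rad (s k)" for k
  have eq: "of_real (\<rho> k) * x = of_real (rad (s k)) * (of_real (rad (s k)) * x)" for k and x :: complex
    by (simp add: \<rho>_def mult.assoc)
  have "filterlim s at_top sequentially"
    by (rule filterlim_at_top_mono[OF filterlim_ident]) (simp add: s)
  then have "(\<lambda>k. rad (s k)) \<longlonglongrightarrow> 1" by (rule filterlim_compose[OF tendsto_rad])
  note tendsto_mult[OF this this]
  then have lim: "\<rho> \<longlonglongrightarrow> 1" by (simp add: \<rho>_def[abs_def])
  have pos: "0 < \<rho> k" "\<rho> k < 1" for k
  proof -
    have "rad (s k) * rad (s k) < 1 * 1" by (rule mult_strict_mono) simp_all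
    then show "0 < \<rho> k" "\<rho> k < 1" by (simp_all only: \<rho>_def mult_pos_pos rad_pos mult_1)
  qed
  have [measurable]: "(\<lambda>x. \<phi> (of_real (\<rho> k) * x)) \<in> borel_measurable circle_borel" for k
  proof (rule borel_measurable_circle, rule continuous_on_compose2[OF holomorphic_on_imp_continuous_on[OF holomorphic]])
    show "continuous_on (sphere 0 1) (\<lambda>x::complex. of_real (\<rho> k) * x)" by (intro continuous_intros)
    show "(\<lambda>x::complex. of_real (\<rho> k) * x) ` sphere 0 1 \<subseteq> ball 0 1"
      using pos[of k] by (auto simp: norm_mult)
  qed
  let ?f = "\<lambda>k \<alpha> x. ennreal ((cmod (\<alpha> - \<phi> (of_real (\<rho> k) * x)))\<^sup>2)"
  have mk: "case_prod (?f k) \<in> borel_measurable (circle_measure \<Otimes>\<^sub>M circle_borel)" for k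
    by measurable
  have meas: "case_prod (\<lambda>\<alpha> x. \<Sum>k. ?f k \<alpha> x) \<in> borel_measurable (circle_measure \<Otimes>\<^sub>M circle_borel)"
    by measurable
  have kernel: "(\<lambda>\<alpha>. \<integral>\<^sup>+x. f \<alpha> x \<partial>clark \<alpha>) \<in> borel_measurable circle_measure"
    if "case_prod f \<in> borel_measurable (circle_measure \<Otimes>\<^sub>M circle_borel)" for f
    by (rule nn_integral_measurable_subprob_algebra2[OF that measurable_clark])
  have slice: "?f k \<alpha> \<in> borel_measurable (clark \<alpha>)" "(\<lambda>x. \<Sum>k. ?f k \<alpha> x) \<in> borel_measurable (clark \<alpha>)" if "cmod \<alpha> = 1" for k \<alpha>
    using sets_clark[OF that] by (simp_all cong: measurable_cong_sets)
  have "(\<integral>\<^sup>+\<alpha>. \<integral>\<^sup>+x. (\<Sum>k. ?f k \<alpha> x) \<partial>clark \<alpha> \<partial>circle_measure)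
      = (\<integral>\<^sup>+\<alpha>. (\<Sum>k. \<integral>\<^sup>+x. ?f k \<alpha> x \<partial>clark \<alpha>) \<partial>circle_measure)"
    by (intro nn_integral_cong nn_integral_suminf slice) simp
  also have "\<dots> = (\<Sum>k. \<integral>\<^sup>+\<alpha>. \<integral>\<^sup>+x. ?f k \<alpha> x \<partial>clark \<alpha> \<partial>circle_measure)"
    by (intro nn_integral_suminf kernel mk)
  also have "\<dots> \<le> (\<Sum>k. ennreal ((1/2)^k))"
  proof (intro suminf_le summableI)
    fix k
    have "(\<integral>\<^sup>+\<alpha>. \<integral>\<^sup>+x. ?f k \<alpha> x \<partial>clark \<alpha> \<partial>circle_measure) \<le> ennreal (2 - 2 * ?I (s k))"
      unfolding eq by (rule clark_L2_distance)
    also have "\<dots> \<le> ennreal ((1/2)^k)" by (intro ennreal_leI s)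
    finally show "(\<integral>\<^sup>+\<alpha>. \<integral>\<^sup>+x. ?f k \<alpha> x \<partial>clark \<alpha> \<partial>circle_measure) \<le> ennreal ((1/2)^k)" .
  qed
  also have "\<dots> < \<infinity>"
    by (subst suminf_ennreal2) (auto intro: summable_geometric)
  finally have fin: "AE \<alpha> in circle_measure. (\<integral>\<^sup>+x. (\<Sum>k. ?f k \<alpha> x) \<partial>clark \<alpha>) \<noteq> \<infinity>"
    by (intro nn_integral_PInf_AE kernel meas) auto
  have "AE \<alpha> in circle_measure. AE x in clark \<alpha>. (\<Sum>k. ?f k \<alpha> x) \<noteq> \<infinity>"
  proof (rule AE_mp[OF fin], rule AE_I2, rule impI)
    show "AE x in clark \<alpha>. (\<Sum>k. ?f k \<alpha> x) \<noteq> \<infinity>"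
      if "\<alpha> \<in> space circle_measure" "(\<integral>\<^sup>+x. (\<Sum>k. ?f k \<alpha> x) \<partial>clark \<alpha>) \<noteq> \<infinity>" for \<alpha>
      using that by (intro nn_integral_PInf_AE slice) auto
  qed
  have "\<forall>k. 0 < \<rho> k \<and> \<rho> k < 1" using pos by blast
  from that[OF this lim meas \<open>AE \<alpha> in circle_measure. AE x in clark \<alpha>. _ \<alpha> x\<close>] show ?thesis .
qed

lemma clark_radial_limit:
  obtains \<rho> :: "nat \<Rightarrow> real" where "\<forall>k. 0 < \<rho> k \<and> \<rho> k < 1" "\<rho> \<longlonglongrightarrow> 1"
    "AE \<alpha> in circle_measure. AE x in clark \<alpha>. (\<lambda>k. \<phi> (of_real (\<rho> k) * x)) \<longlonglongrightarrow> \<alpha>"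
proof -
  obtain \<rho> :: "nat \<Rightarrow> real" where \<rho>: "\<forall>k. 0 < \<rho> k \<and> \<rho> k < 1" "\<rho> \<longlonglongrightarrow> 1"
    and "case_prod (\<lambda>\<alpha> x. \<Sum>k. ennreal ((cmod (\<alpha> - \<phi> (of_real (\<rho> k) * x)))\<^sup>2))
      \<in> borel_measurable (circle_measure \<Otimes>\<^sub>M circle_borel)"
    and ae: "AE \<alpha> in circle_measure. AE x in clark \<alpha>. (\<Sum>k. ennreal ((cmod (\<alpha> - \<phi> (of_real (\<rho> k) * x)))\<^sup>2)) \<noteq> \<infinity>"
    by (rule clark_carrier)
  have "AE \<alpha> in circle_measure. AE x in clark \<alpha>. (\<lambda>k. \<phi> (of_real (\<rho> k) * x)) \<longlonglongrightarrow> \<alpha>"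
  proof (rule AE_mp[OF ae], rule AE_I2, rule impI)
    fix \<alpha> assume "AE x in clark \<alpha>. (\<Sum>k. ennreal ((cmod (\<alpha> - \<phi> (of_real (\<rho> k) * x)))\<^sup>2)) \<noteq> \<infinity>"
    then show "AE x in clark \<alpha>. (\<lambda>k. \<phi> (of_real (\<rho> k) * x)) \<longlonglongrightarrow> \<alpha>"
      by eventually_elim (rule square_summable_tendsto)
  qed
  from that[OF \<rho> this] show ?thesis .
qed

text \<open>
  For \<open>\<sigma>\<^sub>\<alpha>\<close>-almost every \<open>x\<close> the values \<open>\<phi>(\<rho>\<^sub>k x)\<close> tend to \<open>\<alpha>\<close>. A given \<open>x\<close> allows only one such
  \<open>\<alpha>\<close>, so by Fubini's theorem the set carrying \<open>\<sigma>\<^sub>\<alpha>\<close> has arc length zero for almost every \<open>\<alpha>\<close>.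
\<close>

lemma clark_singular:
  "AE \<alpha> in circle_measure. \<exists>N\<in>sets circle_borel. emeasure circle_measure N = 0 \<and>
    emeasure (clark \<alpha>) (space (clark \<alpha>) - N) = 0"
proof -
  obtain \<rho> :: "nat \<Rightarrow> real" where "\<forall>k. 0 < \<rho> k \<and> \<rho> k < 1" "\<rho> \<longlonglongrightarrow> 1"
    and m: "case_prod (\<lambda>\<alpha> x. \<Sum>k. ennreal ((cmod (\<alpha> - \<phi> (of_real (\<rho> k) * x)))\<^sup>2))
      \<in> borel_measurable (circle_measure \<Otimes>\<^sub>M circle_borel)"
    and ae: "AE \<alpha> in circle_measure. AE x in clark \<alpha>. (\<Sum>k. ennreal ((cmod (\<alpha> - \<phi> (of_real (\<rho> k) * x)))\<^sup>2)) \<noteq> \<infinity>"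
    by (rule clark_carrier)
  define S where "S \<alpha> x = (\<Sum>k. ennreal ((cmod (\<alpha> - \<phi> (of_real (\<rho> k) * x)))\<^sup>2))" for \<alpha> x
  note m = m[folded S_def] and ae = ae[folded S_def]
  interpret pair_sigma_finite circle_measure circle_measure ..
  have m': "case_prod S \<in> borel_measurable (circle_measure \<Otimes>\<^sub>M circle_measure)"
    using m by (simp cong: measurable_cong_sets sets_pair_measure_cong)
  have "AE x in circle_measure. AE \<alpha> in circle_measure. S \<alpha> x = \<infinity>"
  proof (rule AE_I2)
    fix x
    have "\<exists>a. \<forall>\<alpha>. \<alpha> \<noteq> a \<longrightarrow> S \<alpha> x = \<infinity>"
    proof (cases "\<exists>a. S a x \<noteq> \<infinity>")
      case True
      then obtain a where a: "S a x \<noteq> \<infinity>" ..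
      have "\<alpha> = a" if "S \<alpha> x \<noteq> \<infinity>" for \<alpha>
        using square_summable_tendsto[OF that[unfolded S_def]] square_summable_tendsto[OF a[unfolded S_def]]
        by (rule LIMSEQ_unique)
      then show ?thesis by blast
    qed auto
    then obtain a where a: "\<And>\<alpha>. \<alpha> \<noteq> a \<Longrightarrow> S \<alpha> x = \<infinity>" by blast
    have "AE \<alpha> in circle_measure. \<alpha> \<noteq> a"
    proof (cases "cmod a = 1")
      case True
      then have "{a} \<in> null_sets circle_measure"
        using circle_measure_singleton[OF True] singleton_in_circle_borel[OF True] by (auto intro: null_setsI)
      from AE_not_in[OF this] show ?thesis by simp
    qed (auto intro!: AE_I2)
    then show "AE \<alpha> in circle_measure. S \<alpha> x = \<infinity>" by eventually_elim (rule a)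
  qed
  then have null: "AE \<alpha> in circle_measure. AE x in circle_measure. S \<alpha> x = \<infinity>"
    by (subst AE_commute) (use m' in measurable)
  show ?thesis
    using null ae AE_space[of circle_measure]
  proof eventually_elim
    fix \<alpha> assume n: "AE x in circle_measure. S \<alpha> x = \<infinity>" and c: "AE x in clark \<alpha>. S \<alpha> x \<noteq> \<infinity>"
      and "\<alpha> \<in> space circle_measure"
    then have \<alpha>: "cmod \<alpha> = 1" by simp
    have ms: "S \<alpha> \<in> borel_measurable circle_borel"
      using measurable_Pair2[OF m, of \<alpha>] \<alpha> by simp
    define N where "N = {x \<in> space circle_borel. S \<alpha> x \<noteq> \<infinity>}"
    have N: "N \<in> sets circle_borel" unfolding N_def using ms by measurable
    show "\<exists>N\<in>sets circle_borel. emeasure circle_measure N = 0 \<and> emeasure (clark \<alpha>) (space (clark \<alpha>) - N) = 0"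
    proof (intro bexI[OF _ N] conjI)
      show "emeasure circle_measure N = 0"
        using n N by (subst AE_iff_measurable[symmetric, of N _ "\<lambda>x. S \<alpha> x = \<infinity>"]) (auto simp: N_def)
      show "emeasure (clark \<alpha>) (space (clark \<alpha>) - N) = 0"
      proof -
        have "AE x in clark \<alpha>. \<not> x \<notin> N"
          using c AE_space by eventually_elim (simp add: N_def space_clark[OF \<alpha>])
        then show ?thesis unfolding set_diff_eq by (rule emeasure_eq_0_AE)
      qed
    qed
  qed
qed

end

section \<open>The inner function of a sum of point masses\<close>

locale unit_point_masses =
  fixes c :: "nat \<Rightarrow> real" and \<zeta> :: "nat \<Rightarrow> complex"
  assumes c_nonneg: "\<And>n. 0 \<le> c n" and c_sums: "c sums 1" and unimodular: "\<And>n. cmod (\<zeta> n) = 1"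
begin

abbreviation H :: "complex \<Rightarrow> complex" where "H \<equiv> herglotz (point_masses c \<zeta>)"

abbreviation \<phi> :: "complex \<Rightarrow> complex" where "\<phi> \<equiv> associated_inner (point_masses c \<zeta>)"

definition energy :: "complex \<Rightarrow> real" where
  "energy z = (\<Sum>n. c n / (cmod (\<zeta> n - z))\<^sup>2)"

lemma c_summable: "summable c" and c_suminf: "suminf c = 1"
  using c_sums by (simp_all add: sums_iff)

lemma c_le_1: "c n \<le> 1"
  using sum_le_suminf[OF c_summable, of "{n}"] c_nonneg c_suminf by simp

lemma dist_ge: "1 - cmod z \<le> cmod (\<zeta> n - z)"
  using dist_circle_ge[OF unimodular] .

lemma dist_le: "cmod z \<le> 1 \<Longrightarrow> cmod (\<zeta> n - z) \<le> 2"
  using norm_triangle_ineq4[of "\<zeta> n" z] unimodular[of n] by simp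

lemma term_bound:
  assumes "cmod z \<le> s" "s < 1"
  shows "norm (c n *\<^sub>R ((\<zeta> n + z) / (\<zeta> n - z))) \<le> c n * (2 / (1 - s))"
proof -
  have "cmod (\<zeta> n + z) \<le> 2" using norm_triangle_ineq[of "\<zeta> n" z] unimodular[of n] assms by simp
  moreover have "1 - s \<le> cmod (\<zeta> n - z)" using dist_ge[of z n] assms by simp
  ultimately have "cmod (\<zeta> n + z) / cmod (\<zeta> n - z) \<le> 2 / (1 - s)"
    using assms by (intro frac_le) auto
  from mult_left_mono[OF this c_nonneg[of n]] show ?thesis
    using c_nonneg[of n] by (simp add: norm_divide)
qed

lemma summable_terms: "cmod z < 1 \<Longrightarrow> summable (\<lambda>n. c n *\<^sub>R ((\<zeta> n + z) / (\<zeta> n - z)))"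
  by (rule summable_comparison_test'[OF summable_mult2[OF c_summable] term_bound]) auto

lemma herglotz_eq_suminf:
  assumes z: "cmod z < 1"
  shows "H z = (\<Sum>n. c n *\<^sub>R ((\<zeta> n + z) / (\<zeta> n - z)))"
proof -
  let ?N = "density (count_space UNIV) (\<lambda>n. ennreal (c n))"
  have \<zeta>: "\<zeta> \<in> measurable ?N circle_borel"
    using unimodular by (auto simp: measurable_def)
  have "H z = (LINT n|?N. (\<zeta> n + z) / (\<zeta> n - z))"
    unfolding herglotz_def point_masses_def by (rule integral_distr[OF \<zeta>]) measurable
  also have "\<dots> = (LINT n|count_space UNIV. c n *\<^sub>R ((\<zeta> n + z) / (\<zeta> n - z)))"
    by (rule integral_density) (auto simp: c_nonneg)
  also have "\<dots> = (\<Sum>n. c n *\<^sub>R ((\<zeta> n + z) / (\<zeta> n - z)))"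
  proof (rule integral_count_space_nat, subst integrable_count_space_nat_iff)
    show "summable (\<lambda>n. norm (c n *\<^sub>R ((\<zeta> n + z) / (\<zeta> n - z))))"
      by (rule summable_comparison_test'[OF summable_mult2[OF c_summable, of "2 / (1 - cmod z)"]])
        (simp only: real_norm_def abs_norm_cancel, rule term_bound[OF order_refl z])
  qed
  finally show ?thesis .
qed

lemma H_holomorphic: "H holomorphic_on ball 0 1"
proof -
  let ?S = "\<lambda>z. \<Sum>n. c n *\<^sub>R ((\<zeta> n + z) / (\<zeta> n - z))"
  have "?S holomorphic_on ball 0 1"
  proof (rule holomorphic_uniform_sequence)
    fix N
    have "\<zeta> n \<noteq> z" if "cmod z < 1" for n z using that unimodular[of n] by auto
    then show "(\<lambda>z. \<Sum>n<N. c n *\<^sub>R ((\<zeta> n + z) / (\<zeta> n - z))) holomorphic_on ball 0 1"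
      unfolding scaleR_conv_of_real by (intro holomorphic_intros) auto
  next
    fix x :: complex assume x: "x \<in> ball 0 1"
    define d where "d = (1 - cmod x) / 2"
    have d: "0 < d" using x by (simp add: d_def)
    have b: "cmod z \<le> 1 - d" if "z \<in> cball x d" for z
      using that norm_triangle_ineq2[of z x] by (simp add: d_def dist_norm norm_minus_commute field_simps)
    have "cball x d \<subseteq> ball 0 1" using b d by fastforce
    moreover have "uniform_limit (cball x d) (\<lambda>N z. \<Sum>n<N. c n *\<^sub>R ((\<zeta> n + z) / (\<zeta> n - z))) ?S sequentially"
      using term_bound[OF b] d
      by (intro Weierstrass_m_test[of _ _ "\<lambda>n. c n * (2 / (1 - (1 - d)))"] summable_mult2 c_summable) auto
    ultimately show "\<exists>d>0. cball x d \<subseteq> ball 0 1 \<and>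
        uniform_limit (cball x d) (\<lambda>N z. \<Sum>n<N. c n *\<^sub>R ((\<zeta> n + z) / (\<zeta> n - z))) ?S sequentially"
      using d by blast
  qed simp
  then show ?thesis by (rule holomorphic_transform) (simp add: herglotz_eq_suminf)
qed

lemma H_0: "H 0 = 1"
proof -
  have "\<zeta> n \<noteq> 0" for n using unimodular[of n] by auto
  then have "H 0 = (\<Sum>n. of_real (c n))" by (simp add: herglotz_eq_suminf scaleR_conv_of_real)
  also have "\<dots> = of_real (suminf c)" by (rule suminf_of_real[OF c_summable, symmetric])
  finally show ?thesis by (simp add: c_suminf)
qed

lemma Re_H_sums: "cmod z < 1 \<Longrightarrow> (\<lambda>n. c n * poisson z (\<zeta> n)) sums Re (H z)"
  using sums_Re[OF summable_sums[OF summable_terms]]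
  by (simp add: herglotz_eq_suminf poisson_eq_Re unimodular)

lemma summable_energy:
  assumes "cmod z < 1" shows "summable (\<lambda>n. c n / (cmod (\<zeta> n - z))\<^sup>2)"
proof (rule summable_comparison_test')
  show "summable (\<lambda>n. c n * (1 / (1 - cmod z)\<^sup>2))" by (rule summable_mult2[OF c_summable])
  fix n
  have "c n / (cmod (\<zeta> n - z))\<^sup>2 \<le> c n / (1 - cmod z)\<^sup>2"
    using dist_ge[of z n] assms c_nonneg[of n]
    by (intro divide_left_mono power_mono mult_pos_pos zero_less_power) auto
  then show "norm (c n / (cmod (\<zeta> n - z))\<^sup>2) \<le> c n * (1 / (1 - cmod z)\<^sup>2)"
    using c_nonneg[of n] by simp
qed

lemma Re_H:
  assumes z: "cmod z < 1" shows "Re (H z) = (1 - (cmod z)\<^sup>2) * energy z"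
proof (rule sums_unique2)
  show "(\<lambda>n. (1 - (cmod z)\<^sup>2) * (c n / (cmod (\<zeta> n - z))\<^sup>2)) sums ((1 - (cmod z)\<^sup>2) * energy z)"
    unfolding energy_def by (intro sums_mult summable_sums summable_energy z)
  show "(\<lambda>n. (1 - (cmod z)\<^sup>2) * (c n / (cmod (\<zeta> n - z))\<^sup>2)) sums Re (H z)"
    using Re_H_sums[OF z] by (simp add: poisson_def mult.commute)
qed

lemma energy_ge: 
  assumes "cmod z < 1" shows "energy z \<ge> 1 / 4"
proof -
  have "(\<lambda>n. c n * (1 / 4)) sums (1 * (1 / 4))" by (rule sums_mult2[OF c_sums])
  moreover have "c n * (1 / 4) \<le> c n / (cmod (\<zeta> n - z))\<^sup>2" for n
  proof -
    have "(cmod (\<zeta> n - z))\<^sup>2 \<le> 2\<^sup>2" using dist_le[of z n] assms by (intro power_mono) auto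
    moreover have "0 < cmod (\<zeta> n - z)" using dist_ge[of z n] assms by linarith
    ultimately have "c n / 2\<^sup>2 \<le> c n / (cmod (\<zeta> n - z))\<^sup>2"
      using c_nonneg[of n] by (intro divide_left_mono) auto
    then show ?thesis by simp
  qed
  ultimately have "1 * (1 / 4) \<le> energy z"
    unfolding energy_def by (intro sums_le[OF _ _ summable_sums[OF summable_energy[OF assms]]])
  then show ?thesis by simp
qed

lemma Re_H_ge: "cmod z < 1 \<Longrightarrow> (1 - (cmod z)\<^sup>2) / 4 \<le> Re (H z)"
  using mult_left_mono[OF energy_ge, of z "1 - (cmod z)\<^sup>2"] by (simp add: Re_H power_le_one)

lemma Re_H_pos:
  assumes "cmod z < 1" shows "0 < Re (H z)"
proof -
  have "(cmod z)\<^sup>2 < 1" using assms by (simp add: power_less_one_iff abs_square_less_1)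
  then have "0 < (1 - (cmod z)\<^sup>2) / 4" by simp
  then show ?thesis using Re_H_ge[OF assms] by (rule less_le_trans)
qed

lemma H_plus_1_nonzero: "cmod z < 1 \<Longrightarrow> H z + 1 \<noteq> 0"
  using Re_H_pos[of z] by (auto simp: complex_eq_iff)

lemma one_minus_phi:
  assumes "cmod z < 1" shows "1 - (cmod (\<phi> z))\<^sup>2 = 4 * Re (H z) / (cmod (H z + 1))\<^sup>2"
proof -
  have "(cmod (H z + 1))\<^sup>2 - (cmod (H z - 1))\<^sup>2 = 4 * Re (H z)"
    unfolding cmod_power2 by (simp add: power2_eq_square algebra_simps)
  moreover have "1 - b / a = (a - b) / a" if "a \<noteq> 0" for a b :: real
    using that by (simp add: field_simps)
  moreover have "(cmod (H z + 1))\<^sup>2 \<noteq> 0" using H_plus_1_nonzero[OF assms] by simp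
  ultimately show ?thesis
    unfolding associated_inner_def norm_divide power_divide by metis
qed

lemma phi_disc_self_map: "disc_self_map \<phi>"
proof
  show "\<phi> holomorphic_on ball 0 1"
    unfolding associated_inner_def using H_plus_1_nonzero
    by (intro holomorphic_intros H_holomorphic) auto
  show "cmod (\<phi> z) < 1" if "cmod z < 1" for z
  proof -
    have "4 * Re (H z) / (cmod (H z + 1))\<^sup>2 > 0"
      using Re_H_pos[OF that] H_plus_1_nonzero[OF that] by (intro divide_pos_pos) auto
    then have "(cmod (\<phi> z))\<^sup>2 < 1" using one_minus_phi[OF that] by linarith
    then show ?thesis by (simp add: abs_square_less_1)
  qed
  show "\<phi> 0 = 0" by (simp add: associated_inner_def H_0)
qed

sublocale disc_self_map \<phi> by (rule phi_disc_self_map)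

text \<open>
  The numerator of \<open>\<alpha> - \<phi>(z)\<close> as a function of \<open>w = H(z)\<close>; for unimodular \<open>\<alpha> \<noteq> 1\<close> its only zero is the imaginary
  number \<open>(1 + \<alpha>) / (1 - \<alpha>)\<close>.
\<close>

definition level :: "complex \<Rightarrow> complex \<Rightarrow> complex" where
  "level \<alpha> w = (\<alpha> - 1) * w + (\<alpha> + 1)"

lemma poisson_phi:
  assumes z: "cmod z < 1"
  shows "poisson (\<phi> z) \<alpha> = 4 * Re (H z) / (cmod (level \<alpha> (H z)))\<^sup>2"
proof -
  have nz: "H z + 1 \<noteq> 0" by (rule H_plus_1_nonzero[OF z])
  then have "\<alpha> - \<phi> z = level \<alpha> (H z) / (H z + 1)"
    by (simp add: associated_inner_def level_def field_simps)
  then show ?thesis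
    unfolding poisson_def one_minus_phi[OF z] using nz by (simp add: norm_divide power_divide)
qed

text \<open>
  Because \<open>cnj (\<alpha> - 1) (\<alpha> + 1)\<close> is purely imaginary.
\<close>

lemma cmod_level_ge:
  assumes \<alpha>: "cmod \<alpha> = 1" shows "cmod (\<alpha> - 1) * Re w \<le> cmod (level \<alpha> w)"
proof (cases "\<alpha> = 1")
  case False
  have 1: "(Re \<alpha>)\<^sup>2 + (Im \<alpha>)\<^sup>2 = 1" using \<alpha> by (simp add: cmod_power2[symmetric])
  have "Re (cnj (\<alpha> - 1) * level \<alpha> w) = (cmod (\<alpha> - 1))\<^sup>2 * Re w + ((Re \<alpha>)\<^sup>2 + (Im \<alpha>)\<^sup>2 - 1)"
    unfolding level_def cmod_power2 by (simp add: power2_eq_square algebra_simps)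
  then have "(cmod (\<alpha> - 1))\<^sup>2 * Re w \<le> cmod (cnj (\<alpha> - 1) * level \<alpha> w)"
    using complex_Re_le_cmod[of "cnj (\<alpha> - 1) * level \<alpha> w"] 1 by linarith
  also have "\<dots> = cmod (\<alpha> - 1) * cmod (level \<alpha> w)" by (simp only: norm_mult complex_mod_cnj)
  finally have "cmod (\<alpha> - 1) * (cmod (\<alpha> - 1) * Re w) \<le> cmod (\<alpha> - 1) * cmod (level \<alpha> w)"
    by (simp add: power2_eq_square)
  then show ?thesis using False by (subst (asm) mult_le_cancel_left_pos) auto
qed simp

text \<open>
  Uses \<open>1 - \<bar>\<phi>\<bar>\<^sup>2 \<le> min 1 (4 Re H)\<close>; since the truncation at \<open>1\<close> is subadditive, it may be applied to
  each point mass separately.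
\<close>

lemma inner_average_le:
  fixes k :: nat
  defines "I \<equiv> \<lambda>n. LINT y|circle_measure. min 1 (4 * (c n * poisson (of_real (rad k) * y) (\<zeta> n)))"
  shows "summable I" "1 - (LINT y|circle_measure. (cmod (\<phi> (of_real (rad k) * y)))\<^sup>2) \<le> suminf I"
    "\<And>n. 0 \<le> I n" "\<And>n. I n \<le> 4 * c n"
proof -
  define g where "g n y = min 1 (4 * (c n * poisson (of_real (rad k) * y) (\<zeta> n)))" for n y
  have gm [measurable]: "g n \<in> borel_measurable circle_borel" for n
    unfolding g_def by measurable
  have z: "cmod (of_real (rad k) * y) < 1" if "cmod y = 1" for y
    using that by (simp add: cmod_rad_less)
  have g0: "0 \<le> g n y" if "cmod y = 1" for n y
    using c_nonneg[of n] poisson_nonneg[OF less_imp_le[OF z[OF that]], of "\<zeta> n"] by (simp add: g_def)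
  have gle: "g n y \<le> 4 * (c n * poisson (of_real (rad k) * \<zeta> n) y)" if "cmod y = 1" for n y
    using that unimodular[of n] by (simp add: g_def poisson_rotate)
  have gi: "integrable circle_measure (g n)" for n
    by (rule circle.integrable_const_bound[of _ 1]) (use g0 in \<open>auto intro!: AE_I2 simp: g_def\<close>)
  have zn: "cmod (of_real (rad k) * \<zeta> n) < 1" for n by (simp add: cmod_rad_less unimodular)
  have ip: "integrable circle_measure (poisson (of_real (rad k) * \<zeta> n))" for n
    by (intro integrable_poisson circle.finite_measure_axioms zn) simp
  have I: "I n = (LINT y|circle_measure. g n y)" for n by (simp add: I_def g_def)
  show I0: "0 \<le> I n" for n unfolding I by (intro integral_nonneg_AE AE_I2 g0) simp
  have "(LINT y|circle_measure. g n y) \<le> (LINT y|circle_measure. 4 * (c n * poisson (of_real (rad k) * \<zeta> n) y))" for n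
    by (intro integral_mono gi integrable_mult_right ip gle) simp
  then show I4: "I n \<le> 4 * c n" for n unfolding I by (simp add: integral_poisson[OF zn])
  show sI: "summable I"
    by (rule summable_comparison_test'[OF summable_mult[OF c_summable]]) (use I0 I4 in simp)
  have sg: "summable (\<lambda>n. g n y)" if y: "cmod y = 1" for y
  proof (rule summable_comparison_test')
    show "summable (\<lambda>n. 4 * (c n * poisson (of_real (rad k) * y) (\<zeta> n)))"
      by (intro summable_mult sums_summable[OF Re_H_sums] z y)
    show "norm (g n y) \<le> 4 * (c n * poisson (of_real (rad k) * y) (\<zeta> n))" for n
      using g0[OF y] by (simp add: g_def)
  qed
  have absg: "\<bar>g n y\<bar> = g n y" if "cmod y = 1" for n y using g0[OF that] by simp
  have s1: "AE y in circle_measure. summable (\<lambda>n. norm (g n y))"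
    by (intro AE_I2) (simp add: absg sg)
  have "(LINT y|circle_measure. norm (g n y)) = I n" for n
    unfolding I by (intro Bochner_Integration.integral_cong refl) (simp add: absg)
  then have s2: "summable (\<lambda>n. LINT y|circle_measure. norm (g n y))" using sI by simp
  have pw: "1 - (cmod (\<phi> (of_real (rad k) * y)))\<^sup>2 \<le> (\<Sum>n. g n y)" if y: "cmod y = 1" for y
  proof -
    let ?z = "of_real (rad k) * y"
    have "1 * 1 \<le> cmod (H ?z + 1) * cmod (H ?z + 1)"
      using Re_H_pos[OF z[OF y]] complex_Re_le_cmod[of "H ?z + 1"] by (intro mult_mono) auto
    then have "1 \<le> (cmod (H ?z + 1))\<^sup>2" by (simp only: power2_eq_square mult_1)
    then have "4 * Re (H ?z) / (cmod (H ?z + 1))\<^sup>2 \<le> 4 * Re (H ?z) / 1"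
      using Re_H_pos[OF z[OF y]] by (intro divide_left_mono) auto
    then have "1 - (cmod (\<phi> ?z))\<^sup>2 \<le> 4 * Re (H ?z)"
      unfolding one_minus_phi[OF z[OF y]] by simp
    moreover have "1 - (cmod (\<phi> ?z))\<^sup>2 \<le> 1" by simp
    moreover have "min 1 (4 * Re (H ?z)) \<le> (\<Sum>n. g n y)"
    \<comment> \<open>A truncated summand makes the sum at least \<open>1\<close>; if there is none, the sum is \<open>4 Re H\<close>.\<close>
    proof (cases "\<exists>n. g n y = 1")
      case True
      then obtain n where "g n y = 1" ..
      then show ?thesis using sum_le_suminf[OF sg[OF y], of "{n}"] g0[OF y] by simp
    next
      case False
      then have "g n y = 4 * (c n * poisson ?z (\<zeta> n))" for n
        by (auto simp: g_def min_def split: if_splits)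
      then show ?thesis using sums_unique[OF sums_mult[OF Re_H_sums[OF z[OF y]], of 4]] by simp
    qed
    ultimately show ?thesis by linarith
  qed
  have "1 - (LINT y|circle_measure. (cmod (\<phi> (of_real (rad k) * y)))\<^sup>2)
      = (LINT y|circle_measure. 1 - (cmod (\<phi> (of_real (rad k) * y)))\<^sup>2)"
    by (subst Bochner_Integration.integral_diff) (auto intro: integrable_norm_radial simp: circle.prob_space)
  also have "\<dots> \<le> (LINT y|circle_measure. (\<Sum>n. g n y))"
    by (intro integral_mono integrable_suminf gi s1 s2 Bochner_Integration.integrable_diff integrable_norm_radial pw) simp_all
  also have "\<dots> = suminf I" unfolding I using integral_suminf[OF gi s1 s2] by simp
  finally show "1 - (LINT y|circle_measure. (cmod (\<phi> (of_real (rad k) * y)))\<^sup>2) \<le> suminf I" .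
qed

text \<open>
  Each truncated summand tends to \<open>0\<close> away from its own pole and is dominated both by \<open>1\<close>, which
  gives convergence of the integrals, and in the mean by \<open>4 c\<^sub>n\<close>, which gives convergence of their sum by
  Tannery's theorem. Without the truncation the integrals would all be equal to \<open>4 c\<^sub>n\<close>.
\<close>

lemma phi_inner: "(\<lambda>k. LINT y|circle_measure. (cmod (\<phi> (of_real (rad k) * y)))\<^sup>2) \<longlonglongrightarrow> 1"
proof -
  define I where "I n k = (LINT y|circle_measure. min 1 (4 * (c n * poisson (of_real (rad k) * y) (\<zeta> n))))" for n k
  have "(\<lambda>k. I n k) \<longlonglongrightarrow> 0" for n
  proof -
    have "(\<lambda>k. I n k) \<longlonglongrightarrow> (LINT y|circle_measure. 0)"
      unfolding I_def
    proof (rule integral_dominated_convergence[where w="\<lambda>_. 1"])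
      have "{\<zeta> n} \<in> null_sets circle_measure"
        using circle_measure_singleton[OF unimodular] singleton_in_circle_borel[OF unimodular] by (auto intro: null_setsI)
      from AE_not_in[OF this] AE_space
      show "AE y in circle_measure. (\<lambda>k. min 1 (4 * (c n * poisson (of_real (rad k) * y) (\<zeta> n)))) \<longlonglongrightarrow> 0"
      proof eventually_elim
        fix y assume "y \<notin> {\<zeta> n}" "y \<in> space circle_measure"
        then have y: "cmod y = 1" "\<zeta> n - y \<noteq> 0" by auto
        have "(\<lambda>k. min 1 (4 * (c n * ((1 - (cmod (of_real (rad k) * y))\<^sup>2) / (cmod (\<zeta> n - of_real (rad k) * y))\<^sup>2))))
          \<longlonglongrightarrow> min 1 (4 * (c n * ((1 - (cmod (of_real 1 * y))\<^sup>2) / (cmod (\<zeta> n - of_real 1 * y))\<^sup>2)))"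
          by (intro tendsto_intros tendsto_rad) (use y in simp)
        then show "(\<lambda>k. min 1 (4 * (c n * poisson (of_real (rad k) * y) (\<zeta> n)))) \<longlonglongrightarrow> 0"
          by (simp add: poisson_def y)
      qed
      show "AE y in circle_measure. norm (min 1 (4 * (c n * poisson (of_real (rad k) * y) (\<zeta> n)))) \<le> 1" for k
      proof (rule AE_I2)
        fix y assume "y \<in> space circle_measure"
        then have "0 \<le> poisson (of_real (rad k) * y) (\<zeta> n)"
          by (intro poisson_nonneg less_imp_le[OF cmod_rad_less]) simp
        then show "norm (min 1 (4 * (c n * poisson (of_real (rad k) * y) (\<zeta> n)))) \<le> 1"
          using c_nonneg[of n] by simp
      qed
    qed (auto intro: circle.integrable_const)
    then show ?thesis by simp
  qed
  moreover have "\<forall>\<^sub>F (n, k) in at_top \<times>\<^sub>F sequentially. norm (I n k) \<le> 4 * c n"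
    using inner_average_le(3,4) by (intro always_eventually) (auto simp: I_def)
  ultimately have "(\<lambda>k. \<Sum>n. I n k) \<longlonglongrightarrow> (\<Sum>n. 0)"
    by (intro tannerys_theorem[THEN conjunct2, THEN conjunct2]) (auto intro: summable_mult c_summable)
  then have lim: "(\<lambda>k. 1 - (\<Sum>n. I n k)) \<longlonglongrightarrow> 1 - 0"
    by (intro tendsto_intros) simp
  show ?thesis
  proof (rule tendsto_sandwich[OF _ _ lim[simplified] tendsto_const])
    show "\<forall>\<^sub>F k in sequentially. 1 - (\<Sum>n. I n k) \<le> (LINT y|circle_measure. (cmod (\<phi> (of_real (rad k) * y)))\<^sup>2)"
      using inner_average_le(2) by (intro always_eventually allI) (simp add: I_def algebra_simps)
    have "(LINT y|circle_measure. (cmod (\<phi> (of_real (rad k) * y)))\<^sup>2) \<le> (LINT y|circle_measure. 1)" for k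
      by (intro integral_mono integrable_norm_radial circle.integrable_const power_le_one
          less_imp_le[OF self_map] cmod_rad_less) auto
    then show "\<forall>\<^sub>F k in sequentially. (LINT y|circle_measure. (cmod (\<phi> (of_real (rad k) * y)))\<^sup>2) \<le> 1"
      by (simp add: circle.prob_space)
  qed
qed

sublocale inner_self_map \<phi> by unfold_locales (rule phi_inner)

end

section \<open>Detecting atoms\<close>

lemma singular_continuous_imp_sc_part:
  assumes \<sigma>: "sets \<sigma> = sets circle_borel" and sc: "singular_continuous \<sigma>"
  shows "\<sigma> = sc_part \<sigma>"
proof -
  have "is_singular_decomposition \<sigma> \<sigma> (null_measure circle_borel)"
    unfolding is_singular_decomposition_def purely_atomic_def
    using \<sigma> sc by (auto intro!: bexI[of _ "{}"])
  from sc_part_eq[OF this] show ?thesis by simp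
qed

lemma purely_atomic_imp_discrete_part:
  assumes \<sigma>: "sets \<sigma> = sets circle_borel" and pa: "purely_atomic \<sigma>"
  shows "\<sigma> = discrete_part \<sigma>"
proof -
  have "singular_continuous (null_measure circle_borel)"
    unfolding singular_continuous_def by (auto intro!: bexI[of _ "{}"])
  then have "is_singular_decomposition \<sigma> (null_measure circle_borel) \<sigma>"
    unfolding is_singular_decomposition_def using \<sigma> pa by auto
  from discrete_part_eq[OF this] show ?thesis by simp
qed

lemma purely_atomic_if_AE_atom:
  assumes fin: "finite_measure \<sigma>" and \<sigma>: "sets \<sigma> = sets circle_borel"
    and ae: "AE x in \<sigma>. measure \<sigma> {x} \<noteq> 0"
  shows "purely_atomic \<sigma>"
proof -
  have sp: "space \<sigma> = sphere 0 1" using sets_eq_imp_space_eq[OF \<sigma>] by simp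
  define C where "C = {x \<in> space \<sigma>. measure \<sigma> {x} \<noteq> 0}"
  have cC: "countable C"
    by (rule countable_subset[OF _ finite_measure.countable_support[OF fin]]) (auto simp: C_def)
  have "(\<Union>x\<in>C. {x}) \<in> sets \<sigma>"
    by (rule sets.countable_UN'[OF cC]) (auto simp: C_def sp \<sigma> intro!: singleton_in_circle_borel)
  then have "C \<in> sets \<sigma>" by simp
  moreover have "AE x in \<sigma>. \<not> x \<notin> C" using ae AE_space by eventually_elim (simp add: C_def)
  then have "emeasure \<sigma> (space \<sigma> - C) = 0" unfolding set_diff_eq by (rule emeasure_eq_0_AE)
  ultimately show ?thesis unfolding purely_atomic_def using cC by blast
qed

text \<open>
  The kernels \<open>(1 - s) P(s x, y)\<close> are bounded by \<open>2\<close> and converge to \<open>2\<close> at \<open>y = x\<close> and to \<open>0\<close> elsewhere.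
\<close>

lemma scaled_poisson_tendsto_atom:
  assumes fin: "finite_measure \<sigma>" and \<sigma>: "sets \<sigma> = sets circle_borel" and x: "cmod x = 1"
  shows "(\<lambda>k. (1 - rad k) * (LINT y|\<sigma>. poisson (of_real (rad k) * x) y)) \<longlonglongrightarrow> 2 * measure \<sigma> {x}"
proof -
  note [measurable_cong] = \<sigma>
  have sp: "space \<sigma> = sphere 0 1" using sets_eq_imp_space_eq[OF \<sigma>] by simp
  have xs [measurable]: "{x} \<in> sets circle_borel" by (rule singleton_in_circle_borel[OF x])
  have z: "cmod (of_real (rad k) * x) < 1" for k using x by (simp add: cmod_rad_less)
  have "(\<lambda>k. LINT y|\<sigma>. (1 - rad k) * poisson (of_real (rad k) * x) y) \<longlonglongrightarrow> (LINT y|\<sigma>. 2 * indicator {x} y)"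
  proof (rule integral_dominated_convergence[where w="\<lambda>_. 2"])
    show "AE y in \<sigma>. (\<lambda>k. (1 - rad k) * poisson (of_real (rad k) * x) y) \<longlonglongrightarrow> 2 * indicator {x} y"
    proof (rule AE_I2)
      fix y assume "y \<in> space \<sigma>"
      then have y: "cmod y = 1" by (simp add: sp)
      show "(\<lambda>k. (1 - rad k) * poisson (of_real (rad k) * x) y) \<longlonglongrightarrow> 2 * indicator {x} y"
      proof (cases "y = x")
        case True
        have "1 - rad k \<noteq> 0" for k using rad_less_1[of k] by linarith
        then have "(1 - rad k) * poisson (of_real (rad k) * x) y = 1 + rad k" for k
          unfolding True poisson_radial_self[OF x rad_less_1] by simp
        moreover have "(\<lambda>k. 1 + rad k) \<longlonglongrightarrow> 1 + 1" by (intro tendsto_intros tendsto_rad)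
        ultimately show ?thesis using True by simp
      next
        case False
        have "(\<lambda>k. (1 - rad k) * ((1 - (cmod (of_real (rad k) * x))\<^sup>2) / (cmod (y - of_real (rad k) * x))\<^sup>2))
          \<longlonglongrightarrow> (1 - 1) * ((1 - (cmod (of_real 1 * x))\<^sup>2) / (cmod (y - of_real 1 * x))\<^sup>2)"
          by (intro tendsto_intros tendsto_rad) (use False in simp)
        then show ?thesis using False by (simp add: poisson_def)
      qed
    qed
    show "AE y in \<sigma>. norm ((1 - rad k) * poisson (of_real (rad k) * x) y) \<le> 2" for k
    proof (rule AE_I2)
      fix y assume "y \<in> space \<sigma>"
      then have y: "cmod y = 1" by (simp add: sp)
      have "poisson (of_real (rad k) * x) y \<le> 2 / (1 - rad k)"
        using poisson_le[OF z y, of k] x by (simp add: norm_mult)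
      then have "(1 - rad k) * poisson (of_real (rad k) * x) y \<le> 2"
        by (simp add: pos_le_divide_eq mult.commute)
      then show "norm ((1 - rad k) * poisson (of_real (rad k) * x) y) \<le> 2"
        using poisson_nonneg[OF less_imp_le[OF z]] by (simp add: abs_mult)
    qed
    show "integrable \<sigma> (\<lambda>_. 2::real)" by (rule finite_measure.integrable_const[OF fin])
  qed measurable
  then show ?thesis using x \<sigma> sp by (simp add: Int_absorb2)
qed

context unit_point_masses
begin

text \<open>
  An atom of mass \<open>a\<close> at \<open>x\<close> forces \<open>a / (1 - s) \<le> (P \<sigma>\<^sub>\<alpha>)(s x)\<close>, while the right side is at most
  \<open>4 / (\<bar>\<alpha> - 1\<bar>\<^sup>2 Re H(s x))\<close> by \<open>cmod_level_ge\<close>. Hence \<open>Re H(s x)\<close>, which is at least \<open>(1 - s)\<close> times the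
  energy, is \<open>O(1 - s)\<close>, and the energy is bounded.
\<close>

lemma energy_bounded_at_atom:
  assumes \<alpha>: "cmod \<alpha> = 1" "\<alpha> \<noteq> 1" and x: "cmod x = 1" and atom: "measure (clark \<alpha>) {x} \<noteq> 0"
  shows "energy (of_real (rad k) * x) \<le> 4 / ((cmod (\<alpha> - 1))\<^sup>2 * measure (clark \<alpha>) {x})"
proof -
  interpret prob_space "clark \<alpha>" by (rule prob_space_clark[OF \<alpha>(1)])
  let ?z = "of_real (rad k) * x" and ?m = "measure (clark \<alpha>) {x}"
  let ?s = "rad k" and ?u = "Re (H (of_real (rad k) * x))" and ?a = "cmod (\<alpha> - 1)"
  have z: "cmod ?z < 1" "cmod ?z = ?s" using x by (auto intro: cmod_rad_less simp: norm_mult)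
  have m: "0 < ?m" using atom measure_nonneg[of "clark \<alpha>" "{x}"] by linarith
  have a: "0 < ?a" using \<alpha>(2) by simp
  have u: "0 < ?u" by (rule Re_H_pos[OF z(1)])
  have xs: "{x} \<in> sets (clark \<alpha>)" using singleton_in_circle_borel[OF x] by (simp add: sets_clark \<alpha>)
  have p1: "1 / (1 - ?s) \<le> poisson ?z x"
    unfolding poisson_radial_self[OF x rad_less_1] by (intro divide_right_mono) auto
  have "(LINT y|clark \<alpha>. indicator {x} y * (1 / (1 - ?s))) \<le> (LINT y|clark \<alpha>. poisson ?z y)"
  proof (rule integral_mono)
    show "integrable (clark \<alpha>) (\<lambda>y. indicator {x} y * (1 / (1 - ?s)))"
      using xs by (intro integrable_mult_left integrable_real_indicator) (auto simp: less_top[symmetric])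
    show "integrable (clark \<alpha>) (poisson ?z)"
      by (intro integrable_poisson finite_measure_axioms sets_clark \<alpha> z)
    show "indicator {x} y * (1 / (1 - ?s)) \<le> poisson ?z y" for y
      using p1 poisson_nonneg[OF less_imp_le[OF z(1)], of y] by (cases "y = x") auto
  qed
  then have "?m / (1 - ?s) \<le> 4 * ?u / (cmod (level \<alpha> (H ?z)))\<^sup>2"
    using xs x by (simp add: poisson_clark[OF \<alpha>(1) z(1)] poisson_phi[OF z(1)] space_clark[OF \<alpha>(1)] Int_absorb2)
  also have "\<dots> \<le> 4 * ?u / (?a * ?u)\<^sup>2"
  proof -
    have au: "0 < ?a * ?u" by (rule mult_pos_pos[OF a u])
    moreover have "0 < cmod (level \<alpha> (H ?z))" by (rule less_le_trans[OF au cmod_level_ge[OF \<alpha>(1)]])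
    ultimately show ?thesis
      using cmod_level_ge[OF \<alpha>(1), of "H ?z"] u \<alpha>(2)
      by (intro divide_left_mono power_mono mult_pos_pos zero_less_power) (simp_all add: less_imp_le)
  qed
  also have "\<dots> = 4 / (?a\<^sup>2 * ?u)" using u by (simp add: power2_eq_square)
  finally have "?m * (?a\<^sup>2 * ?u) \<le> 4 * (1 - ?s)"
    using a u by (simp add: pos_le_divide_eq pos_divide_le_eq field_simps)
  moreover have "(1 - ?s) * energy ?z \<le> ?u"
  proof -
    have "1 - ?s \<le> 1 - ?s\<^sup>2" using mult_left_mono[of ?s 1 ?s] by (simp add: power2_eq_square)
    then show ?thesis unfolding Re_H[OF z(1)] z(2)
      using energy_ge[OF z(1)] by (intro mult_right_mono) auto
  qed
  then have "?m * (?a\<^sup>2 * ((1 - ?s) * energy ?z)) \<le> ?m * (?a\<^sup>2 * ?u)"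
    using m by (intro mult_left_mono) auto
  ultimately have "(1 - ?s) * (?m * ?a\<^sup>2 * energy ?z) \<le> (1 - ?s) * 4"
    by (simp add: mult_ac)
  then have "?m * ?a\<^sup>2 * energy ?z \<le> 4" by (subst (asm) mult_le_cancel_left_pos) auto
  then show ?thesis using m a by (simp add: pos_le_divide_eq mult_ac)
qed

text \<open>
  Each \<open>n\<close> in the set contributes at least \<open>1\<close> to the energy at points of the radius close to \<open>x\<close>.
\<close>

lemma finite_near_atom:
  assumes \<alpha>: "cmod \<alpha> = 1" "\<alpha> \<noteq> 1" and x: "cmod x = 1" and atom: "measure (clark \<alpha>) {x} \<noteq> 0"
  shows "finite {n. cmod (\<zeta> n - x) < sqrt (c n)}"
proof (rule ccontr)
  assume inf: "infinite {n. cmod (\<zeta> n - x) < sqrt (c n)}"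
  define K where "K = 4 / ((cmod (\<alpha> - 1))\<^sup>2 * measure (clark \<alpha>) {x})"
  \<comment> \<open>\<open>N\<close> points of the set would give energy at least \<open>N\<close>, above its bound \<open>K\<close>.\<close>
  obtain N :: nat where N: "K < N" using reals_Archimedean2 by blast
  obtain F where F: "finite F" "card F = N" "F \<subseteq> {n. cmod (\<zeta> n - x) < sqrt (c n)}"
    using infinite_arbitrarily_large[OF inf] by blast
  have "\<forall>\<^sub>F k in sequentially. \<forall>n\<in>F. cmod (\<zeta> n - of_real (rad k) * x) < sqrt (c n)"
  proof (rule eventually_ball_finite[OF F(1)], rule ballI)
    fix n assume "n \<in> F"
    have "(\<lambda>k. cmod (\<zeta> n - of_real (rad k) * x)) \<longlonglongrightarrow> cmod (\<zeta> n - of_real 1 * x)"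
      by (intro tendsto_intros tendsto_rad)
    then show "\<forall>\<^sub>F k in sequentially. cmod (\<zeta> n - of_real (rad k) * x) < sqrt (c n)"
      by (rule order_tendstoD(2)) (use F(3) \<open>n \<in> F\<close> in auto)
  qed
  then obtain k where k: "\<And>n. n \<in> F \<Longrightarrow> cmod (\<zeta> n - of_real (rad k) * x) < sqrt (c n)"
    unfolding eventually_sequentially by blast
  let ?z = "of_real (rad k) * x"
  have z: "cmod ?z < 1" using x by (simp add: cmod_rad_less)
  have "1 \<le> c n / (cmod (\<zeta> n - ?z))\<^sup>2" if "n \<in> F" for n
  proof -
    have "0 < cmod (\<zeta> n - ?z)" using dist_ge[of ?z n] z by linarith
    moreover have "(cmod (\<zeta> n - ?z))\<^sup>2 \<le> (sqrt (c n))\<^sup>2" using k[OF that] by (intro power_mono) auto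
    ultimately show ?thesis using c_nonneg[of n] by (simp add: pos_le_divide_eq)
  qed
  then have "(\<Sum>n\<in>F. 1) \<le> (\<Sum>n\<in>F. c n / (cmod (\<zeta> n - ?z))\<^sup>2)" by (intro sum_mono)
  also have "\<dots> \<le> energy ?z"
    unfolding energy_def by (intro sum_le_suminf summable_energy z F(1)) (simp add: c_nonneg)
  also have "\<dots> \<le> K" unfolding K_def by (rule energy_bounded_at_atom[OF assms])
  finally show False using N F(2) by simp
qed

text \<open>
  By \<open>AE_clark\<close>, almost every Clark measure gives no mass to the points excluded by the assumption,
  and by \<open>finite_near_atom\<close> these are the only points that can be atoms.
\<close>

lemma clark_continuous:
  assumes "AE x in circle_measure. infinite {n. cmod (\<zeta> n - x) < sqrt (c n)}"
  shows "AE \<alpha> in circle_measure. \<alpha> \<noteq> 1 \<longrightarrow> clark \<alpha> = sc_part (clark \<alpha>)"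
  using AE_clark[OF assms] clark_singular AE_space
proof eventually_elim
  fix \<alpha> assume ae: "AE x in clark \<alpha>. infinite {n. cmod (\<zeta> n - x) < sqrt (c n)}"
    and sing: "\<exists>N\<in>sets circle_borel. emeasure circle_measure N = 0 \<and> emeasure (clark \<alpha>) (space (clark \<alpha>) - N) = 0"
    and "\<alpha> \<in> space circle_measure"
  then have \<alpha>: "cmod \<alpha> = 1" by simp
  interpret prob_space "clark \<alpha>" by (rule prob_space_clark[OF \<alpha>])
  show "\<alpha> \<noteq> 1 \<longrightarrow> clark \<alpha> = sc_part (clark \<alpha>)"
  proof (intro impI singular_continuous_imp_sc_part sets_clark \<alpha>)
    assume "\<alpha> \<noteq> 1"
    have "emeasure (clark \<alpha>) {x} = 0" if "x \<in> space (clark \<alpha>)" for x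
    proof (rule ccontr)
      assume nz: "emeasure (clark \<alpha>) {x} \<noteq> 0"
      have x: "cmod x = 1" using that by (simp add: space_clark \<alpha>)
      have xs: "{x} \<in> sets (clark \<alpha>)" using singleton_in_circle_borel[OF x] by (simp add: sets_clark \<alpha>)
      have m: "measure (clark \<alpha>) {x} \<noteq> 0" using nz by (simp add: emeasure_eq_measure)
      have "AE y in clark \<alpha>. y \<notin> {x}"
        using ae finite_near_atom[OF \<alpha> \<open>\<alpha> \<noteq> 1\<close> x m] by (auto elim: eventually_mono)
      then have "emeasure (clark \<alpha>) {x} = 0"
        using xs by (subst (asm) AE_iff_null_sets[symmetric]) auto
      with nz show False ..
    qed
    with sing show "singular_continuous (clark \<alpha>)" unfolding singular_continuous_def by blast
  qed
qed

end

section \<open>Summable square roots: purely atomic Clark measures\<close>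

text \<open>
  The kernel at the point \<open>(1 - t) \<zeta>\<close> is of size \<open>1 / t\<close> on the arc \<open>\<bar>\<zeta> - x\<bar> < t\<close> and
  of size \<open>t / \<bar>\<zeta> - x\<bar>\<^sup>2\<close> outside. As it has integral \<open>1\<close>, the left side has integral at most \<open>4 t\<close>.
\<close>

lemma truncated_inverse_square_le_poisson:
  assumes t: "0 \<le> t" "t \<le> 1" and \<zeta>: "cmod \<zeta> = 1" and x: "cmod x = 1"
  shows "min 1 (t\<^sup>2 / (cmod (\<zeta> - x))\<^sup>2) \<le> 4 * t * poisson (of_real (1 - t) * \<zeta>) x"
proof (cases "t = 0")
  case False
  with t have t0: "0 < t" by simp
  define d where "d = cmod (\<zeta> - x)"
  define q where "q = cmod (x - of_real (1 - t) * \<zeta>)"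
  have z: "cmod (of_real (1 - t) * \<zeta>) = 1 - t" using t \<zeta> by (simp only: norm_mult norm_of_real) simp
  have "t \<le> q" using dist_circle_ge[OF x, of "of_real (1 - t) * \<zeta>"] unfolding z q_def by simp
  then have q0: "0 < q" using t0 by simp
  have "q = cmod ((x - \<zeta>) + of_real t * \<zeta>)" unfolding q_def by (simp add: algebra_simps)
  also have "\<dots> \<le> cmod (x - \<zeta>) + cmod (of_real t * \<zeta>)" by (rule norm_triangle_ineq)
  also have "\<dots> = d + t" using t \<zeta> by (simp add: d_def norm_mult norm_minus_commute)
  finally have qd: "q \<le> d + t" .
  have "t \<le> t * (2 - t)" using t mult_left_mono[of 1 "2 - t" t] by simp
  also have "t * (2 - t) = 1 - (1 - t)\<^sup>2" by (simp add: power2_eq_square algebra_simps)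
  finally have "t / q\<^sup>2 \<le> poisson (of_real (1 - t) * \<zeta>) x"
    unfolding poisson_def z q_def[symmetric] by (intro divide_right_mono) auto
  then have p: "4 * t * (t / q\<^sup>2) \<le> 4 * t * poisson (of_real (1 - t) * \<zeta>) x"
    using t by (intro mult_left_mono) auto
  show ?thesis
  proof (cases "t \<le> d")
    case True
    then have "q\<^sup>2 \<le> (2 * d)\<^sup>2" using qd q0 by (intro power_mono) auto
    then have "4 * t\<^sup>2 / (2 * d)\<^sup>2 \<le> 4 * t\<^sup>2 / q\<^sup>2"
      using q0 True t0 by (intro divide_left_mono mult_pos_pos zero_less_power) auto
    then have "t\<^sup>2 / d\<^sup>2 \<le> 4 * t * (t / q\<^sup>2)" by (simp add: power2_eq_square)
    from order_trans[OF this p] have "t\<^sup>2 / d\<^sup>2 \<le> 4 * t * poisson (of_real (1 - t) * \<zeta>) x" .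
    then show ?thesis unfolding d_def by (rule min.coboundedI2)
  next
    case False
    then have "q\<^sup>2 \<le> (2 * t)\<^sup>2" using qd q0 by (intro power_mono) auto
    then have "1 \<le> 4 * t * (t / q\<^sup>2)" using q0 by (simp add: power2_eq_square pos_le_divide_eq)
    from order_trans[OF this p] have "1 \<le> 4 * t * poisson (of_real (1 - t) * \<zeta>) x" .
    then show ?thesis by (rule min.coboundedI1)
  qed
qed simp

lemma summable_if_summable_truncation:
  fixes a :: "nat \<Rightarrow> real"
  assumes a: "\<And>n. 0 \<le> a n" and s: "summable (\<lambda>n. min 1 (a n))"
  shows "summable a"
proof -
  have "\<forall>\<^sub>F n in sequentially. min 1 (a n) < 1"
    using summable_LIMSEQ_zero[OF s] by (rule order_tendstoD(2)) simp
  then have "\<forall>\<^sub>F n in sequentially. min 1 (a n) = a n" by eventually_elim (simp add: min_def split: if_splits)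
  from summable_cong[OF this] s show ?thesis by simp
qed

context unit_point_masses
begin

text \<open>
  With \<open>t = sqrt c\<^sub>n\<close>, the truncated terms have integrals at most \<open>4 sqrt c\<^sub>n\<close>, so their sum is finite
  almost everywhere. Points \<open>\<zeta>\<^sub>n\<close> are excluded explicitly since the \<open>n\<close>-th term counts as \<open>0\<close> there.
\<close>

lemma AE_summable_inverse_square:
  assumes s: "summable (\<lambda>n. sqrt (c n))"
  shows "AE x in circle_measure. x \<notin> range \<zeta> \<and> summable (\<lambda>n. c n / (cmod (\<zeta> n - x))\<^sup>2)"
proof -
  have "range \<zeta> \<in> null_sets circle_measure"
  proof -
    have "(\<Union>n. {\<zeta> n}) \<in> null_sets circle_measure"
      using circle_measure_singleton[OF unimodular] singleton_in_circle_borel[OF unimodular]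
      by (intro null_sets_UN) (auto intro: null_setsI)
    then show ?thesis by (simp add: UNION_singleton_eq_range)
  qed
  from AE_not_in[OF this] have nr: "AE x in circle_measure. x \<notin> range \<zeta>" .
  let ?g = "\<lambda>n x. min 1 (c n / (cmod (\<zeta> n - x))\<^sup>2)"
  have gm: "(\<lambda>x. ennreal (?g n x)) \<in> borel_measurable circle_measure" for n by measurable
  have le: "(\<integral>\<^sup>+x. ennreal (?g n x) \<partial>circle_measure) \<le> ennreal (4 * sqrt (c n))" for n
  proof (cases "c n = 0")
    case False
    define t where "t = sqrt (c n)"
    have t: "0 < t" "t \<le> 1" "t\<^sup>2 = c n"
      using c_nonneg[of n] c_le_1[of n] False by (simp_all add: t_def)
    have z: "cmod (of_real (1 - t) * \<zeta> n) < 1"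
      using t unimodular[of n] by (simp only: norm_mult norm_of_real) simp
    have ip: "integrable circle_measure (poisson (of_real (1 - t) * \<zeta> n))"
      by (intro integrable_poisson circle.finite_measure_axioms z) simp
    have "(\<integral>\<^sup>+x. ennreal (?g n x) \<partial>circle_measure)
        \<le> (\<integral>\<^sup>+x. ennreal (4 * t * poisson (of_real (1 - t) * \<zeta> n) x) \<partial>circle_measure)"
      using truncated_inverse_square_le_poisson[of t "\<zeta> n"] t unimodular[of n]
      by (intro nn_integral_mono ennreal_leI) simp
    also have "\<dots> = ennreal (LINT x|circle_measure. 4 * t * poisson (of_real (1 - t) * \<zeta> n) x)"
      by (intro nn_integral_eq_integral integrable_mult_right ip AE_I2 mult_nonneg_nonneg poisson_nonneg less_imp_le[OF z])
        (use t in auto)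
    also have "(LINT x|circle_measure. 4 * t * poisson (of_real (1 - t) * \<zeta> n) x) = 4 * t"
      by (simp only: Bochner_Integration.integral_mult_right_zero integral_poisson[OF z] mult_1_right)
    finally show ?thesis by (simp add: t_def)
  qed simp
  have "(\<integral>\<^sup>+x. (\<Sum>n. ennreal (?g n x)) \<partial>circle_measure) = (\<Sum>n. \<integral>\<^sup>+x. ennreal (?g n x) \<partial>circle_measure)"
    by (rule nn_integral_suminf[OF gm])
  also have "\<dots> \<le> (\<Sum>n. ennreal (4 * sqrt (c n)))" by (intro suminf_le summableI le)
  also have "\<dots> < \<infinity>"
    by (subst suminf_ennreal2) (auto intro: summable_mult s simp: c_nonneg)
  finally have "AE x in circle_measure. (\<Sum>n. ennreal (?g n x)) \<noteq> \<infinity>"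
    by (intro nn_integral_PInf_AE borel_measurable_suminf_order gm) auto
  then have "AE x in circle_measure. summable (\<lambda>n. c n / (cmod (\<zeta> n - x))\<^sup>2)"
  proof eventually_elim
    fix x assume "(\<Sum>n. ennreal (?g n x)) \<noteq> \<infinity>"
    then have "summable (\<lambda>n. ?g n x)"
      by (intro summable_suminf_not_top) (auto simp: c_nonneg)
    then show "summable (\<lambda>n. c n / (cmod (\<zeta> n - x))\<^sup>2)"
      by (rule summable_if_summable_truncation[rotated]) (simp add: c_nonneg)
  qed
  with nr show ?thesis by eventually_elim simp
qed

text \<open>
  Termwise, \<open>(\<zeta> + r x) / (\<zeta> - r x) - (\<zeta> + x) / (\<zeta> - x) = 2 \<zeta> x (r - 1) / ((\<zeta> - r x) (\<zeta> - x))\<close>, and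
  \<open>\<bar>\<zeta> - x\<bar> \<le> 2 \<bar>\<zeta> - r x\<bar>\<close>.
\<close>

lemma herglotz_boundary_Lipschitz:
  assumes x: "cmod x = 1" "x \<notin> range \<zeta>" and G: "summable (\<lambda>n. c n / (cmod (\<zeta> n - x))\<^sup>2)"
  obtains h where "\<And>r. 0 \<le> r \<Longrightarrow> r < 1 \<Longrightarrow> cmod (H (of_real r * x) - h) \<le> 4 * (1 - r) * energy x"
proof -
  let ?T = "\<lambda>w n. c n *\<^sub>R ((\<zeta> n + w) / (\<zeta> n - w))"
  have nx: "\<zeta> n - x \<noteq> 0" for n using x(2) by auto
  have le: "norm (?T (of_real r * x) n - ?T x n) \<le> 4 * (1 - r) * (c n / (cmod (\<zeta> n - x))\<^sup>2)"
    if r: "0 \<le> r" "r < 1" for r n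
  proof -
    let ?w = "of_real r * x"
    have w: "cmod ?w = r" using x r by (simp add: norm_mult)
    have p: "1 - r \<le> cmod (\<zeta> n - ?w)" using dist_ge[of ?w n] w by simp
    then have nw: "\<zeta> n - ?w \<noteq> 0" using r by auto
    have "(\<zeta> n + ?w) / (\<zeta> n - ?w) - (\<zeta> n + x) / (\<zeta> n - x) = 2 * \<zeta> n * x * of_real (r - 1) / ((\<zeta> n - ?w) * (\<zeta> n - x))"
      using nx[of n] nw by (simp add: divide_simps) (simp add: algebra_simps)
    then have "cmod ((\<zeta> n + ?w) / (\<zeta> n - ?w) - (\<zeta> n + x) / (\<zeta> n - x))
        = 2 * (1 - r) / (cmod (\<zeta> n - ?w) * cmod (\<zeta> n - x))"
      using r x(1) unimodular[of n] by (simp only: norm_divide norm_mult norm_of_real) simp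
    also have "\<dots> \<le> 2 * (1 - r) / ((cmod (\<zeta> n - x) / 2) * cmod (\<zeta> n - x))"
    proof -
      have "cmod (\<zeta> n - x) = cmod ((\<zeta> n - ?w) - of_real (1 - r) * x)" by (simp add: algebra_simps)
      also have "\<dots> \<le> cmod (\<zeta> n - ?w) + cmod (of_real (1 - r) * x)" by (rule norm_triangle_ineq4)
      also have "cmod (of_real (1 - r) * x) = 1 - r" using x(1) r by (simp only: norm_mult norm_of_real) simp
      finally have "cmod (\<zeta> n - x) / 2 \<le> cmod (\<zeta> n - ?w)" using p by simp
      then show ?thesis using nx[of n] nw r by (intro divide_left_mono mult_right_mono mult_pos_pos) auto
    qed
    also have "\<dots> = 4 * (1 - r) / (cmod (\<zeta> n - x))\<^sup>2" by (simp add: power2_eq_square)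
    finally have "c n * cmod ((\<zeta> n + ?w) / (\<zeta> n - ?w) - (\<zeta> n + x) / (\<zeta> n - x)) \<le> c n * (4 * (1 - r) / (cmod (\<zeta> n - x))\<^sup>2)"
      by (rule mult_left_mono[OF _ c_nonneg])
    then show ?thesis
      using c_nonneg[of n] by (simp add: scaleR_diff_right[symmetric] mult_ac)
  qed
  have sb: "summable (\<lambda>n. 4 * (1 - r) * (c n / (cmod (\<zeta> n - x))\<^sup>2))" for r
    by (rule summable_mult[OF G])
  have sd: "summable (\<lambda>n. ?T (of_real r * x) n - ?T x n)" if "0 \<le> r" "r < 1" for r
    by (rule summable_comparison_test'[OF sb le[OF that]])
  have s0: "summable (?T (of_real r * x))" if "0 \<le> r" "r < 1" for r
    using that x(1) by (intro summable_terms) (simp add: norm_mult)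
  \<comment> \<open>The series at \<open>x\<close> converges because it differs from the one at the centre by a summable one.\<close>
  have sx: "summable (?T x)"
    using summable_diff[OF s0[of 0] sd[of 0]] by simp
  show ?thesis
  proof (rule that[of "suminf (?T x)"])
    fix r :: real assume r: "0 \<le> r" "r < 1"
    have "H (of_real r * x) - suminf (?T x) = (\<Sum>n. ?T (of_real r * x) n - ?T x n)"
      using r x(1) by (subst herglotz_eq_suminf) (simp_all add: norm_mult suminf_diff[OF s0[OF r] sx])
    also have "cmod \<dots> \<le> (\<Sum>n. 4 * (1 - r) * (c n / (cmod (\<zeta> n - x))\<^sup>2))"
      by (rule norm_suminf_le[OF le[OF r] sb])
    also have "\<dots> = 4 * (1 - r) * energy x" unfolding energy_def by (rule suminf_mult[OF G])
    finally show "cmod (H (of_real r * x) - suminf (?T x)) \<le> 4 * (1 - r) * energy x" .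
  qed
qed

text \<open>
  Let \<open>h\<close> be the radial limit of \<open>H\<close> at \<open>x\<close>. Since \<open>\<phi>\<close> tends to \<open>\<alpha>\<close>, \<open>level \<alpha> h = 0\<close>, so
  \<open>level \<alpha> (H (s x))\<close> is \<open>O(1 - s)\<close>. As \<open>Re H(s x)\<close> is at least a multiple of \<open>1 - s\<close>, the Poisson
  integral of \<open>\<sigma>\<^sub>\<alpha>\<close> at \<open>s x\<close> is at least a multiple of \<open>1 / (1 - s)\<close>, which detects an atom by
  \<open>scaled_poisson_tendsto_atom\<close>.
\<close>

lemma atom_if_radial_limit:
  assumes \<alpha>: "cmod \<alpha> = 1" "\<alpha> \<noteq> 1"
    and x: "cmod x = 1" "x \<notin> range \<zeta>" and G: "summable (\<lambda>n. c n / (cmod (\<zeta> n - x))\<^sup>2)"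
    and \<rho>: "\<forall>k. 0 < \<rho> k \<and> \<rho> k < 1" "\<rho> \<longlonglongrightarrow> 1" "(\<lambda>k. \<phi> (of_real (\<rho> k) * x)) \<longlonglongrightarrow> \<alpha>"
  shows "measure (clark \<alpha>) {x} \<noteq> 0"
proof -
  obtain h where h: "\<And>r. 0 \<le> r \<Longrightarrow> r < 1 \<Longrightarrow> cmod (H (of_real r * x) - h) \<le> 4 * (1 - r) * energy x"
    using herglotz_boundary_Lipschitz[OF x G] by blast
  have zr: "cmod (of_real r * x) < 1" if "0 \<le> r" "r < 1" for r using that x(1) by (simp add: norm_mult)
  have "(\<lambda>k. H (of_real (\<rho> k) * x) - h) \<longlonglongrightarrow> 0"
  proof (rule Lim_null_comparison)
    show "\<forall>\<^sub>F k in sequentially. cmod (H (of_real (\<rho> k) * x) - h) \<le> 4 * (1 - \<rho> k) * energy x"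
      using \<rho>(1) by (intro always_eventually allI h) (auto simp: less_imp_le)
    have "(\<lambda>k. 4 * (1 - \<rho> k) * energy x) \<longlonglongrightarrow> 4 * (1 - 1) * energy x" by (intro tendsto_intros \<rho>(2))
    then show "(\<lambda>k. 4 * (1 - \<rho> k) * energy x) \<longlonglongrightarrow> 0" by simp
  qed
  then have Hlim: "(\<lambda>k. H (of_real (\<rho> k) * x)) \<longlonglongrightarrow> h" by (rule LIM_zero_cancel)
  have "level \<alpha> (H (of_real (\<rho> k) * x)) = (\<alpha> - \<phi> (of_real (\<rho> k) * x)) * (H (of_real (\<rho> k) * x) + 1)" for k
    using H_plus_1_nonzero[OF zr[of "\<rho> k"]] \<rho>(1)
    by (simp add: associated_inner_def level_def field_simps less_imp_le)
  moreover have "(\<lambda>k. (\<alpha> - \<phi> (of_real (\<rho> k) * x)) * (H (of_real (\<rho> k) * x) + 1)) \<longlonglongrightarrow> (\<alpha> - \<alpha>) * (h + 1)"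
    by (intro tendsto_intros \<rho>(3) Hlim)
  ultimately have "(\<lambda>k. level \<alpha> (H (of_real (\<rho> k) * x))) \<longlonglongrightarrow> 0" by simp
  moreover have "(\<lambda>k. level \<alpha> (H (of_real (\<rho> k) * x))) \<longlonglongrightarrow> level \<alpha> h"
    unfolding level_def by (intro tendsto_intros Hlim)
  ultimately have lev0: "level \<alpha> h = 0" by (rule LIMSEQ_unique[rotated])
  have diff: "level \<alpha> w = (\<alpha> - 1) * (w - h)" for w
    using lev0 by (simp add: level_def algebra_simps)
  have lower: "1 / (64 * (energy x)\<^sup>2) \<le> (1 - rad k) * (LINT y|clark \<alpha>. poisson (of_real (rad k) * x) y)"
    and E: "0 < energy x" for k
  proof -
    let ?z = "of_real (rad k) * x" and ?s = "rad k"
    let ?L = "cmod (level \<alpha> (H ?z))"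
    have z: "cmod ?z < 1" "cmod ?z = ?s" using x(1) by (auto intro: cmod_rad_less simp: norm_mult)
    have s: "0 < 1 - ?s" by simp
    have "?L \<le> 2 * (4 * (1 - ?s) * energy x)"
      unfolding diff norm_mult using norm_triangle_ineq4[of \<alpha> 1] \<alpha>(1) by (intro mult_mono h) auto
    moreover have L0: "0 < ?L"
      using cmod_level_ge[OF \<alpha>(1), of "H ?z"] mult_pos_pos[of "cmod (\<alpha> - 1)"] Re_H_pos[OF z(1)] \<alpha>(2)
      by (smt (verit) right_minus_eq zero_less_norm_iff)
    ultimately have L: "?L \<le> 8 * (1 - ?s) * energy x" by linarith
    then have "0 < 8 * (1 - ?s) * energy x" using L0 by linarith
    then show "0 < energy x" using s by (simp add: zero_less_mult_iff)
    have "1 - ?s \<le> 1 - ?s\<^sup>2" using mult_left_mono[of ?s 1 ?s] by (simp add: power2_eq_square)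
    moreover have "1 - ?s\<^sup>2 \<le> 4 * Re (H ?z)" using Re_H_ge[OF z(1)] unfolding z(2) by (simp add: divide_le_eq mult.commute)
    ultimately have u: "1 - ?s \<le> 4 * Re (H ?z)" by (rule order_trans)
    have "?L\<^sup>2 \<le> (8 * (1 - ?s) * energy x)\<^sup>2" using L L0 by (intro power_mono) auto
    then have "(1 - ?s) / (8 * (1 - ?s) * energy x)\<^sup>2 \<le> 4 * Re (H ?z) / ?L\<^sup>2"
      using u s L0 Re_H_pos[OF z(1)] by (intro frac_le) auto
    then have "(1 - ?s) * ((1 - ?s) / (8 * (1 - ?s) * energy x)\<^sup>2) \<le> (1 - ?s) * (4 * Re (H ?z) / ?L\<^sup>2)"
      using s by (intro mult_left_mono) auto
    moreover have "d * (d / (8 * d * e)\<^sup>2) = 1 / (64 * e\<^sup>2)" if "0 < d" "0 < e" for d e :: real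
      using that by (simp add: field_simps power2_eq_square)
    from this[OF s \<open>0 < energy x\<close>]
    have "(1 - ?s) * ((1 - ?s) / (8 * (1 - ?s) * energy x)\<^sup>2) = 1 / (64 * (energy x)\<^sup>2)" .
    ultimately show "1 / (64 * (energy x)\<^sup>2) \<le> (1 - ?s) * (LINT y|clark \<alpha>. poisson ?z y)"
      by (simp add: poisson_clark[OF \<alpha>(1) z(1)] poisson_phi[OF z(1)])
  qed
  have "1 / (64 * (energy x)\<^sup>2) \<le> 2 * measure (clark \<alpha>) {x}"
    by (rule LIMSEQ_le_const[OF scaled_poisson_tendsto_atom[OF finite_measure_clark sets_clark x(1)]])
      (use lower \<alpha>(1) in auto)
  moreover have "0 < 1 / (64 * (energy x)\<^sup>2)" using E by simp
  ultimately show ?thesis by linarith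
qed

text \<open>
  For almost every \<open>\<alpha>\<close>, the hypotheses of \<open>atom_if_radial_limit\<close> on \<open>x\<close> hold \<open>\<sigma>\<^sub>\<alpha>\<close>-almost everywhere: the
  radial limit by \<open>clark_radial_limit\<close>, the summability because it holds for \<open>m\<close>-almost every \<open>x\<close>.
\<close>

lemma clark_atomic:
  assumes "summable (\<lambda>n. sqrt (c n))"
  shows "AE \<alpha> in circle_measure. clark \<alpha> = discrete_part (clark \<alpha>)"
proof -
  obtain \<rho> :: "nat \<Rightarrow> real" where \<rho>: "\<forall>k. 0 < \<rho> k \<and> \<rho> k < 1" "\<rho> \<longlonglongrightarrow> 1"
    and lim: "AE \<alpha> in circle_measure. AE x in clark \<alpha>. (\<lambda>k. \<phi> (of_real (\<rho> k) * x)) \<longlonglongrightarrow> \<alpha>"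
    by (rule clark_radial_limit)
  have "{1} \<in> null_sets circle_measure"
    using circle_measure_singleton[of 1] singleton_in_circle_borel[of 1] by (auto intro: null_setsI)
  from AE_not_in[OF this] lim AE_clark[OF AE_summable_inverse_square[OF assms]] AE_space
  show ?thesis
  proof eventually_elim
    fix \<alpha> assume "\<alpha> \<notin> {1}" "\<alpha> \<in> space circle_measure"
      and l: "AE x in clark \<alpha>. (\<lambda>k. \<phi> (of_real (\<rho> k) * x)) \<longlonglongrightarrow> \<alpha>"
      and e: "AE x in clark \<alpha>. x \<notin> range \<zeta> \<and> summable (\<lambda>n. c n / (cmod (\<zeta> n - x))\<^sup>2)"
    then have \<alpha>: "cmod \<alpha> = 1" "\<alpha> \<noteq> 1" by auto
    have "AE x in clark \<alpha>. measure (clark \<alpha>) {x} \<noteq> 0"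
      using l e AE_space
    proof eventually_elim
      fix x assume "(\<lambda>k. \<phi> (of_real (\<rho> k) * x)) \<longlonglongrightarrow> \<alpha>"
        "x \<notin> range \<zeta> \<and> summable (\<lambda>n. c n / (cmod (\<zeta> n - x))\<^sup>2)" "x \<in> space (clark \<alpha>)"
      then show "measure (clark \<alpha>) {x} \<noteq> 0"
        by (intro atom_if_radial_limit[OF \<alpha> _ _ _ \<rho>]) (auto simp: space_clark \<alpha>)
    qed
    then show "clark \<alpha> = discrete_part (clark \<alpha>)"
      by (intro purely_atomic_imp_discrete_part purely_atomic_if_AE_atom finite_measure_clark sets_clark \<alpha>)
  qed
qed

end

section \<open>Divergent square roots: the random points\<close>

lemma cmod_cis_diff_le: "cmod (cis a - cis b) \<le> \<bar>a - b\<bar>"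
proof -
  have 1: "(cos t)\<^sup>2 = 1 - (sin t)\<^sup>2" for t :: real by (simp add: cos_squared_eq)
  have "(cmod (cis a - cis b))\<^sup>2 = (cos a - cos b)\<^sup>2 + (sin a - sin b)\<^sup>2"
    by (simp add: cmod_power2)
  also have "\<dots> = 2 - 2 * cos (a - b)"
    by (simp add: power2_diff cos_diff 1 algebra_simps)
  also have "\<dots> = (2 * sin ((a - b) / 2))\<^sup>2"
  proof -
    have "2 * ((a - b) / 2) = a - b" by simp
    with cos_double_sin[of "(a - b) / 2"] have "cos (a - b) = 1 - 2 * (sin ((a - b) / 2))\<^sup>2" by (simp only:)
    then show ?thesis by (simp add: power_mult_distrib)
  qed
  finally have "(cmod (cis a - cis b))\<^sup>2 = (2 * sin ((a - b) / 2))\<^sup>2" .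
  then have "cmod (cis a - cis b) = \<bar>2 * sin ((a - b) / 2)\<bar>"
    by (simp only: power2_eq_iff_nonneg[OF norm_ge_zero abs_ge_zero] power2_abs[of "2 * sin ((a - b) / 2)", symmetric])
  also have "\<dots> \<le> \<bar>a - b\<bar>" using abs_sin_x_le_abs_x[of "(a - b) / 2"] by (simp add: abs_mult)
  finally show ?thesis .
qed

text \<open>
  Of the two arcs of angular length \<open>t\<close> that end at the angle of \<open>x\<close>, at least one does not cross
  the cut at angle \<open>0\<close>.
\<close>

lemma uniform_law_near_point:
  assumes x: "cmod x = 1" and t: "0 \<le> t" "t \<le> 1"
  shows "t / (2*pi) \<le> measure (uniform_measure lborel {0..<2*pi}) {s. cmod (cis s - x) < t}"
proof -
  interpret prob_space "uniform_measure lborel {0..<2*pi}" by (rule prob_space_uniform_law)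
  obtain a where a: "0 \<le> a" "a < 2 * pi" "x = cis a"
    using complex_unimodular_polar[OF x] by (metis cis.code)
  have near: "cmod (cis s - x) < t" if "\<bar>s - a\<bar> < t" for s
    using cmod_cis_diff_le[of s a] that a(3) by simp
  have m: "{s. cmod (cis s - x) < t} \<in> sets borel"
    by (intro borel_open open_Collect_less continuous_intros)
  obtain J where J: "J \<in> sets borel" "J \<subseteq> {0..<2*pi}" "measure lborel J = t" "J \<subseteq> {s. cmod (cis s - x) < t}"
  proof (cases "a + t \<le> 2 * pi")
    case True
    show ?thesis
      by (rule that[of "{a..<a+t}"]) (use a t True near in auto)
  next
    case False
    then show ?thesis
      using pi_gt3 by (intro that[of "{a-t<..a}"]) (use a t near in auto)
  qed
  have "t / (2*pi) = measure (uniform_measure lborel {0..<2*pi}) J"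
    using J by (subst measure_uniform_measure) (auto simp: Int_absorb1)
  also have "\<dots> \<le> measure (uniform_measure lborel {0..<2*pi}) {s. cmod (cis s - x) < t}"
    using J(4) m by (intro finite_measure_mono) auto
  finally show ?thesis .
qed

text \<open>
  The second Borel-Cantelli lemma: by independence, the probability of staying away from \<open>x\<close> for all \<open>n\<close>
  from \<open>N\<close> to \<open>N + m - 1\<close> is at most \<open>exp (- \<Sum> t\<^sub>n / (2 \<pi>))\<close>, summed over these \<open>n\<close>, and this tends
  to \<open>0\<close> as \<open>m\<close> grows.
\<close>

lemma (in prob_space) AE_infinitely_often_near:
  fixes \<theta> :: "nat \<Rightarrow> 'a \<Rightarrow> real" and t :: "nat \<Rightarrow> real"
  assumes indep: "indep_vars (\<lambda>_. borel) \<theta> UNIV"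
    and unif: "\<And>n. distr M borel (\<theta> n) = uniform_measure lborel {0..<2*pi}"
    and t: "\<And>n. 0 \<le> t n" "\<And>n. t n \<le> 1" "\<not> summable t" and x: "cmod x = 1"
  shows "AE \<omega> in M. infinite {n. cmod (cis (\<theta> n \<omega>) - x) < t n}"
proof -
  have [measurable]: "\<theta> n \<in> borel_measurable M" for n
    using indep by (auto simp: indep_vars_def)
  define F where "F n = {s. \<not> cmod (cis s - x) < t n}" for n
  have F [measurable]: "F n \<in> sets borel" for n
    unfolding F_def not_less by (intro borel_closed closed_Collect_le continuous_intros)
  have probF: "prob (\<theta> n -` F n \<inter> space M) \<le> exp (- (t n / (2*pi)))" for n
  proof -
    interpret U: prob_space "uniform_measure lborel {0..<2*pi}" by (rule prob_space_uniform_law)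
    have "prob (\<theta> n -` F n \<inter> space M) = measure (distr M borel (\<theta> n)) (F n)"
      by (rule measure_distr[symmetric]) measurable
    also have "\<dots> = 1 - measure (uniform_measure lborel {0..<2*pi}) {s. cmod (cis s - x) < t n}"
    proof -
      have F_eq: "F n = space (uniform_measure lborel {0..<2*pi}) - {s. cmod (cis s - x) < t n}"
        by (auto simp: F_def)
      have "{s. cmod (cis s - x) < t n} \<in> sets borel"
        by (intro borel_open open_Collect_less continuous_intros)
      then show ?thesis unfolding unif F_eq by (intro U.prob_compl) simp
    qed
    also have "\<dots> \<le> 1 + - (t n / (2*pi))" using uniform_law_near_point[OF x t(1,2), of n] by simp
    also have "\<dots> \<le> exp (- (t n / (2*pi)))" by (rule exp_ge_add_one_self)
    finally show ?thesis .
  qed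
  have null: "AE \<omega> in M. \<exists>n\<ge>N. cmod (cis (\<theta> n \<omega>) - x) < t n" for N
  proof -
    define E where "E = (\<Inter>n\<in>{N..}. \<theta> n -` F n \<inter> space M)"
    have E: "E \<in> sets M" unfolding E_def by measurable
    \<comment> \<open>The case \<open>m = 0\<close> is separate as independence is stated for non-empty index sets.\<close>
    have upper: "prob E \<le> exp (- ((\<Sum>n<m. t (n + N)) / (2*pi)))" for m
    proof (cases "m = 0")
      case False
      have "prob E \<le> prob (\<Inter>n\<in>{N..<N+m}. \<theta> n -` F n \<inter> space M)"
        using False by (intro finite_measure_mono) (auto simp: E_def)
      also have "\<dots> = (\<Prod>n\<in>{N..<N+m}. prob (\<theta> n -` F n \<inter> space M))"
        using False by (intro indep_varsD[OF indep]) auto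
      also have "\<dots> \<le> (\<Prod>n\<in>{N..<N+m}. exp (- (t n / (2*pi))))"
        by (intro prod_mono conjI measure_nonneg probF)
      also have "\<dots> = exp (\<Sum>n\<in>{N..<N+m}. - (t n / (2*pi)))" by (simp add: exp_sum)
      also have "(\<Sum>n\<in>{N..<N+m}. - (t n / (2*pi))) = (\<Sum>n<m. - (t (n + N) / (2*pi)))"
        by (rule sum.reindex_bij_witness[of _ "\<lambda>n. n + N" "\<lambda>n. n - N"]) auto
      also have "\<dots> = - ((\<Sum>n<m. t (n + N)) / (2*pi))" by (simp add: sum_negf sum_divide_distrib)
      finally show ?thesis .
    qed simp
    have "prob E \<le> 0"
    proof (rule ccontr)
      assume "\<not> prob E \<le> 0"
      then have pos: "0 < prob E" by simp
      have "(\<Sum>n<m. t (n + N)) \<le> - ln (prob E) * (2*pi)" for m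
      proof -
        have "ln (prob E) \<le> ln (exp (- ((\<Sum>n<m. t (n + N)) / (2*pi))))"
          using pos upper[of m] by (subst ln_le_cancel_iff) auto
        then have "(\<Sum>n<m. t (n + N)) / (2*pi) \<le> - ln (prob E)" by simp
        then show ?thesis by (subst (asm) pos_divide_le_eq) simp_all
      qed
      then have "summable (\<lambda>n. t (n + N))" by (intro summableI_nonneg_bounded t)
      with t(3) show False by (simp add: summable_iff_shift)
    qed
    then have "E \<in> null_sets M" using E by (simp add: null_sets_def emeasure_eq_measure measure_le_0_iff)
    from AE_not_in[OF this] AE_space show ?thesis
      by eventually_elim (auto simp: E_def F_def)
  qed
  have "AE \<omega> in M. \<forall>N. \<exists>n\<ge>N. cmod (cis (\<theta> n \<omega>) - x) < t n"
    using null by (simp add: AE_all_countable)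
  then show ?thesis by eventually_elim (auto simp: infinite_nat_iff_unbounded_le)
qed

theorem corollary1p3:
  fixes M :: "'w measure" and \<theta> :: "nat \<Rightarrow> 'w \<Rightarrow> real" and c :: "nat \<Rightarrow> real"
    and \<phi> :: "'w \<Rightarrow> complex \<Rightarrow> complex"
  assumes "prob_space M"
    and "\<And>n. c n \<ge> 0"
    and "c sums 1"
    and "prob_space.indep_vars M (\<lambda>_. borel) \<theta> UNIV"
    and "\<And>n. distr M borel (\<theta> n) = uniform_measure lborel {0..<2*pi}"
    and "\<And>\<omega>. \<phi> \<omega> = associated_inner (point_masses c (\<lambda>n. cis (\<theta> n \<omega>)))"
  shows "(summable (\<lambda>n. sqrt (c n)) \<longrightarrow>
      (AE \<omega> in M. AE \<alpha> in circle_measure.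
        clark_measure (\<phi> \<omega>) \<alpha> = discrete_part (clark_measure (\<phi> \<omega>) \<alpha>))) \<and>
    (\<not> summable (\<lambda>n. sqrt (c n)) \<longrightarrow>
      (AE \<omega> in M. AE \<alpha> in circle_measure. \<alpha> \<noteq> 1 \<longrightarrow>
        clark_measure (\<phi> \<omega>) \<alpha> = sc_part (clark_measure (\<phi> \<omega>) \<alpha>)))"
proof (intro conjI impI)
  have pm: "unit_point_masses c (\<lambda>n. cis (\<theta> n \<omega>))" for \<omega>
    by unfold_locales (use assms(2,3) in auto)
  interpret prob_space M by (rule assms(1))
  show "AE \<omega> in M. AE \<alpha> in circle_measure.
      clark_measure (\<phi> \<omega>) \<alpha> = discrete_part (clark_measure (\<phi> \<omega>) \<alpha>)"
    if "summable (\<lambda>n. sqrt (c n))"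
    unfolding assms(6) by (intro AE_I2 unit_point_masses.clark_atomic[OF pm that])
  show "AE \<omega> in M. AE \<alpha> in circle_measure. \<alpha> \<noteq> 1 \<longrightarrow>
      clark_measure (\<phi> \<omega>) \<alpha> = sc_part (clark_measure (\<phi> \<omega>) \<alpha>)"
    if div: "\<not> summable (\<lambda>n. sqrt (c n))"
  proof -
    have [measurable]: "\<theta> n \<in> borel_measurable M" for n
      using assms(4) by (auto simp: indep_vars_def)
    have c1: "c n \<le> 1" for n
      by (rule unit_point_masses.c_le_1[OF pm])
    interpret pair_sigma_finite circle_measure M ..
    have "AE x in circle_measure. AE \<omega> in M. infinite {n. cmod (cis (\<theta> n \<omega>) - x) < sqrt (c n)}"
      by (intro AE_I2 AE_infinitely_often_near assms(4,5) div) (auto simp: assms(2) c1)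
    then have "AE \<omega> in M. AE x in circle_measure. infinite {n. cmod (cis (\<theta> n \<omega>) - x) < sqrt (c n)}"
      unfolding infinite_nat_iff_unbounded_le mem_Collect_eq
      by (subst (asm) AE_commute) measurable
    then show ?thesis
      unfolding assms(6) by eventually_elim (rule unit_point_masses.clark_continuous[OF pm])
  qed
qed

end
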